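(* Let $K\neq\mathbb{F}_2$ be a field, $n\ge3$, $V$ an $n$-dimensional $K$-vector space, and let $S=\{t_\alpha=1+v_\alpha\otimes\phi_\alpha:\alpha\in I\}\subseteq SL(V)$ be a set of transvections. Then $S^K$ generates $Sp(V)$ if and only if $S$ has properties (P1) and (P2) but does not have property (P3).
   Context: A transvection is $1+d\otimes\phi\in SL(V)$ acting by $x\mapsto x+\phi(x)d$, $0\ne d\in V$, $0\neq\phi\in V^*$, $\phi(d)=0$; $t^K=\{1+\lambda d\otimes\phi:\lambda\in K\}$ and $S^K=\bigcup_\alpha t_\alpha^K$. $Sp(V)$ denotes the symplectic group of a non-degenerate alternating bilinear form on $V$ (so "$S^K$ generates $Sp(V)$" means $\langle S^K\rangle$ is the full isometry group of some non-degenerate alternating bilinear form on $V$). $\Gamma(S)$ is the directed graph on $S\setminus\{1\}$ with an edge from $1+d_1\otimes\phi_1$ to $1+d_2\otimes\phi_2$ iff $\phi_2(d_1)\neq0$. A cycle in $\Gamma(S)$ is a sequence of $k\ge3$ distinct vertices $r_1,\ldots,r_k$, $r_i=1+v_i\otimes\phi_i$, with $(r_i,r_{i+1})$ an edge for all $i$ (indices mod $k$); it is non-singular if $\prod_{i=1}^k\phi_i(v_{i+1})+(-1)^{k-1}\prod_{i=1}^k\phi_{i+1}(v_i)\neq0$. Properties: (P1) $\langle v_\alpha:\alpha\in I\rangle=V$ and $\langle\phi_\alpha:\alpha\in I\rangle=V^*$; (P2) $\Gamma(S)$ is strongly connected; (P3) $\Gamma(S)$ contains a non-singular cycle. *)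

theory Defs
  imports "HOL-Analysis.Analysis"
begin

text \<open>V = K^n realised as the type 'a^'n (K = 'a a field, n = CARD('n)).
  A linear functional phi in V* is represented by its coordinate vector;
  its value at x is fapp phi x.\<close>

definition fapp :: "'a::field^'n \<Rightarrow> 'a^'n \<Rightarrow> 'a" where
  "fapp phi x = (\<Sum>i\<in>UNIV. phi $ i * x $ i)"

text \<open>The transvection 1 + d (x) phi, i.e. x |-> x + phi(x) d.\<close>
definition transv :: "'a::field^'n \<Rightarrow> 'a^'n \<Rightarrow> 'a^'n^'n" where
  "transv d phi = mat 1 + (\<chi> i j. d $ i * phi $ j)"

definition is_transvection_data :: "'a::field^'n \<Rightarrow> 'a^'n \<Rightarrow> bool" where
  "is_transvection_data d phi \<longleftrightarrow> d \<noteq> 0 \<and> phi \<noteq> 0 \<and> fapp phi d = 0"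

text \<open>Subgroup of GL(V) generated by a set of matrices.\<close>
inductive_set gen_group :: "('a::field^'n^'n) set \<Rightarrow> ('a^'n^'n) set"
  for A where
    gg_one: "mat 1 \<in> gen_group A"
  | gg_gen: "a \<in> A \<Longrightarrow> a \<in> gen_group A"
  | gg_mult: "a \<in> gen_group A \<Longrightarrow> b \<in> gen_group A \<Longrightarrow> a ** b \<in> gen_group A"
  | gg_inv: "a \<in> gen_group A \<Longrightarrow> b ** a = mat 1 \<Longrightarrow> a ** b = mat 1 \<Longrightarrow> b \<in> gen_group A"

text \<open>Bilinear form B_J(x,y) = x^T J y.\<close>
definition bform :: "'a::field^'n^'n \<Rightarrow> 'a^'n \<Rightarrow> 'a^'n \<Rightarrow> 'a" where
  "bform J x y = (\<Sum>i\<in>UNIV. x $ i * (J *v y) $ i)"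

definition nondeg_alternating :: "'a::field^'n^'n \<Rightarrow> bool" where
  "nondeg_alternating J \<longleftrightarrow>
     (\<forall>x. bform J x x = 0) \<and> (\<forall>x. (\<forall>y. bform J x y = 0) \<longrightarrow> x = 0)"

text \<open>Isometry group of the form B_J.\<close>
definition symplectic_group :: "'a::field^'n^'n \<Rightarrow> ('a^'n^'n) set" where
  "symplectic_group J = {g. \<forall>x y. bform J (g *v x) (g *v y) = bform J x y}"

text \<open>Family of transvections t_alpha = 1 + v_alpha (x) phi_alpha, alpha in I.\<close>

definition SK :: "'i set \<Rightarrow> ('i \<Rightarrow> 'a::field^'n) \<Rightarrow> ('i \<Rightarrow> 'a^'n) \<Rightarrow> ('a^'n^'n) set" where
  "SK I v phi = {transv ((lam :: 'a) *s v a) (phi a) | lam a. a \<in> I}"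

definition P1 :: "'i set \<Rightarrow> ('i \<Rightarrow> 'a::field^'n) \<Rightarrow> ('i \<Rightarrow> 'a^'n) \<Rightarrow> bool" where
  "P1 I v phi \<longleftrightarrow> vec.span (v ` I) = UNIV \<and> vec.span (phi ` I) = UNIV"

text \<open>Edge relation of Gamma(S) on the vertex set S - {1}.\<close>
definition gamma_edge :: "'i set \<Rightarrow> ('i \<Rightarrow> 'a::field^'n) \<Rightarrow> ('i \<Rightarrow> 'a^'n) \<Rightarrow> (('a^'n^'n) \<times> ('a^'n^'n)) set" where
  "gamma_edge I v phi = {(r1, r2). r1 \<noteq> mat 1 \<and> r2 \<noteq> mat 1 \<and>
      (\<exists>a\<in>I. \<exists>b\<in>I. r1 = transv (v a) (phi a) \<and> r2 = transv (v b) (phi b) \<and> fapp (phi b) (v a) \<noteq> 0)}"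

definition P2 :: "'i set \<Rightarrow> ('i \<Rightarrow> 'a::field^'n) \<Rightarrow> ('i \<Rightarrow> 'a^'n) \<Rightarrow> bool" where
  "P2 I v phi \<longleftrightarrow>
     (\<forall>r1\<in>(\<lambda>a. transv (v a) (phi a)) ` I - {mat 1}. \<forall>r2\<in>(\<lambda>a. transv (v a) (phi a)) ` I - {mat 1}.
        (r1, r2) \<in> (gamma_edge I v phi)\<^sup>*)"

text \<open>A cycle is given by a list cs of indices (representatives r_i = t_(cs!i)),
  with k = length cs >= 3 distinct vertices and edges (r_i, r_(i+1)) mod k.\<close>
definition nonsingular_cycle :: "'i set \<Rightarrow> ('i \<Rightarrow> 'a::field^'n) \<Rightarrow> ('i \<Rightarrow> 'a^'n) \<Rightarrow> 'i list \<Rightarrow> bool" where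
  "nonsingular_cycle I v phi cs \<longleftrightarrow>
     (let k = length cs; t = (\<lambda>a. transv (v a) (phi a)) in
       k \<ge> 3 \<and> set cs \<subseteq> I \<and> distinct (map t cs) \<and> mat 1 \<notin> t ` set cs \<and>
       (\<forall>i<k. fapp (phi (cs ! ((i + 1) mod k))) (v (cs ! i)) \<noteq> 0) \<and>
       (\<Prod>i<k. fapp (phi (cs ! i)) (v (cs ! ((i + 1) mod k))))
         + (-1) ^ (k - 1) * (\<Prod>i<k. fapp (phi (cs ! ((i + 1) mod k))) (v (cs ! i))) \<noteq> 0)"

definition P3 :: "'i set \<Rightarrow> ('i \<Rightarrow> 'a::field^'n) \<Rightarrow> ('i \<Rightarrow> 'a^'n) \<Rightarrow> bool" where
  "P3 I v phi \<longleftrightarrow> (\<exists>cs. nonsingular_cycle I v phi cs)"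

end

theory Submission
  imports Defs
begin

text \<open>
  Necessity. If the group generated by S^K is the isometry group of B, then, because a property
  of the form "g moves every x of a subspace N only inside a subspace W" passes from generators to
  products, it holds for the symplectic transvections x |-> x + B(u, x) u as soon as it holds
  for S^K. Such transvections move a fixed nonzero x in the direction of an arbitrary u, so W is
  everything. Taking W the span of the v_a gives (P1) for the v_a, taking N the line through a
  vector killed by all phi_a gives (P1) for the phi_a, and taking W spanned by the v_a reachable
  in Gamma(S) gives (P2). Finally a transvection preserving B has the form x |-> x + c B(d, x) d,
  so phi_a = c_a B(v_a, -), and the two products defining a nonsingular cycle cancel.

  Sufficiency. Without nonsingular cycles the signed ratio of the two products of edge labels
  along a walk depends only on its end points, since a closed walk splits into simple cycles.
  This potential c makes (a, b) |-> phi_a(v_b) / c_a skew, which yields a nondegenerate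
  alternating form B with phi_a = c_a B(v_a, -); thus S^K consists of all symplectic transvections
  with directions v_a. The set of directions u all of whose symplectic transvections lie in the
  generated group is closed under u |-> u + t w whenever B(w, u) is nonzero; with |K| > 2 and the
  connectivity of Gamma(S) it contains every nonzero vector, and symplectic transvections generate
  the symplectic group.
\<close>

section \<open>Transvections and the symplectic group\<close>

lemma fapp_add_right: "fapp p (x + y) = fapp p x + fapp p y"
  by (simp add: fapp_def sum.distrib algebra_simps)

lemma fapp_add_left: "fapp (p + q) x = fapp p x + fapp q x"
  by (simp add: fapp_def sum.distrib algebra_simps)

lemma fapp_scale_right: "fapp p (c *s x) = c * fapp p x"
  by (simp add: fapp_def sum_distrib_left algebra_simps)

lemma fapp_scale_left: "fapp (c *s p) x = c * fapp p x"
  by (simp add: fapp_def sum_distrib_left algebra_simps)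

lemma fapp_zero_right [simp]: "fapp p 0 = 0"
  by (simp add: fapp_def)

lemma fapp_zero_left [simp]: "fapp 0 x = 0"
  by (simp add: fapp_def)

lemma fapp_commute: "fapp p x = fapp x p"
  by (simp add: fapp_def mult.commute)

lemma fapp_axis: "fapp p (axis i 1) = p $ i"
  by (simp add: fapp_def axis_def if_distrib cong: if_cong)

lemma fapp_ext: "(\<And>x. fapp p x = fapp q x) \<Longrightarrow> p = q"
  by (metis fapp_axis vec_eq_iff)

lemma fapp_eq_0_on_span:
  assumes "x \<in> vec.span S" and "\<And>s. s \<in> S \<Longrightarrow> fapp p s = 0"
  shows "fapp p x = 0"
  using assms by (induct rule: vec.span_induct_alt) (auto simp: fapp_add_right fapp_scale_right)

lemma nonzero_vector_has_nonzero_fapp: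
  fixes x :: "'a::field^'n"
  assumes "x \<noteq> 0"
  shows "\<exists>i. fapp (axis i 1) x \<noteq> 0"
  using assms by (metis fapp_axis fapp_commute vec_eq_iff zero_index)

lemma transv_apply: "transv d p *v x = x + fapp p x *s d"
proof -
  have "(\<chi> i j. d $ i * p $ j) *v x = fapp p x *s d"
    by (simp add: matrix_vector_mult_def fapp_def vec_eq_iff sum_distrib_left mult_ac)
  then show ?thesis by (simp add: transv_def matrix_vector_mult_add_rdistrib)
qed

lemma transv_eqI: "(\<And>x. fapp p x *s d = fapp p' x *s d') \<Longrightarrow> transv d p = transv d' p'"
  by (simp add: matrix_eq transv_apply)

lemma transv_eqD: "transv d p = transv d' p' \<Longrightarrow> fapp p x *s d = fapp p' x *s d'"
  by (metis add_left_cancel transv_apply)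

lemma transv_scale: "transv (a *s d) (b *s p) = transv ((a * b) *s d) p"
  by (rule transv_eqI) (simp add: fapp_scale_left)

lemma transv_neq_mat1:
  assumes "is_transvection_data d p"
  shows "transv d p \<noteq> mat 1"
proof
  assume "transv d p = mat 1"
  then have "fapp p x *s d = 0" for x
    by (metis add_cancel_left_right matrix_vector_mul_lid transv_apply)
  moreover obtain i where "fapp p (axis i 1) \<noteq> 0"
    using assms nonzero_vector_has_nonzero_fapp fapp_commute
    unfolding is_transvection_data_def by metis
  ultimately show False
    using assms unfolding is_transvection_data_def by (metis vector_mul_eq_0)
qed

lemma transv_add:
  assumes "fapp p d = 0"
  shows "transv (a *s d) p ** transv (b *s d) p = transv ((a + b) *s d) p"
  using assms
  by (simp add: matrix_eq matrix_vector_mul_assoc[symmetric] transv_apply fapp_add_right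
      fapp_scale_right algebra_simps)

lemma bform_add_right: "bform J x (y + z) = bform J x y + bform J x z"
  by (simp add: bform_def matrix_vector_right_distrib sum.distrib distrib_left)

lemma bform_add_left: "bform J (x + y) z = bform J x z + bform J y z"
  by (simp add: bform_def sum.distrib algebra_simps)

lemma bform_scale_right: "bform J x (c *s y) = c * bform J x y"
  by (simp add: bform_def sum_distrib_left vector_scalar_commute mult_ac)

lemma bform_scale_left: "bform J (c *s x) y = c * bform J x y"
  by (simp add: bform_def sum_distrib_left algebra_simps)

lemma bform_zero_right [simp]: "bform J x 0 = 0"
  by (simp add: bform_def)

lemma bform_zero_left [simp]: "bform J 0 x = 0"
  by (simp add: bform_def)

lemma bform_diff_right: "bform J x (y - z) = bform J x y - bform J x z"
  by (simp add: bform_def matrix_vector_mult_diff_distrib sum_subtractf right_diff_distrib)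

lemma bform_diff_left: "bform J (x - y) z = bform J x z - bform J y z"
  by (simp add: bform_def sum_subtractf algebra_simps)

lemma bform_sum_zero: "p + q + r = 0 \<Longrightarrow> bform J u p + bform J u q + bform J u r = 0"
  by (metis bform_add_right bform_zero_right)

lemma fapp_vector_matrix_mult: "fapp (u v* J) x = bform J u x"
proof -
  have "fapp (u v* J) x = (\<Sum>i\<in>UNIV. \<Sum>k\<in>UNIV. u $ k * J $ k $ i * x $ i)"
    by (simp add: fapp_def vector_matrix_mult_def sum_distrib_right)
  also have "\<dots> = (\<Sum>k\<in>UNIV. \<Sum>i\<in>UNIV. u $ k * J $ k $ i * x $ i)"
    by (rule sum.swap)
  also have "\<dots> = bform J u x"
    by (simp add: bform_def matrix_vector_mult_def sum_distrib_left mult_ac)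
  finally show ?thesis .
qed

definition symp_transv :: "'a::field^'n^'n \<Rightarrow> 'a^'n \<Rightarrow> 'a \<Rightarrow> 'a^'n^'n" where
  "symp_transv J u c = transv (c *s u) (u v* J)"

lemma symp_transv_apply: "symp_transv J u c *v x = x + (c * bform J u x) *s u"
  by (simp add: symp_transv_def transv_apply fapp_vector_matrix_mult fapp_scale_left)

lemma symp_transv_zero [simp]: "symp_transv J u 0 = mat 1"
  by (simp add: matrix_eq symp_transv_apply)

lemma symp_transv_zero_vec [simp]: "symp_transv J 0 c = mat 1"
  by (simp add: matrix_eq symp_transv_apply)

lemma symp_transv_scale: "symp_transv J (s *s u) c = symp_transv J u (s * s * c)"
  by (simp add: matrix_eq symp_transv_apply bform_scale_left algebra_simps)

lemma mem_symplectic_group_iff: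
  "g \<in> symplectic_group J \<longleftrightarrow> (\<forall>x y. bform J (g *v x) (g *v y) = bform J x y)"
  by (simp add: symplectic_group_def)

lemma symplectic_group_one: "mat 1 \<in> symplectic_group J"
  by (simp add: mem_symplectic_group_iff)

lemma symplectic_group_mult:
  "g \<in> symplectic_group J \<Longrightarrow> h \<in> symplectic_group J \<Longrightarrow> g ** h \<in> symplectic_group J"
  by (simp add: mem_symplectic_group_iff matrix_vector_mul_assoc[symmetric])

lemma symplectic_group_inverse:
  "g \<in> symplectic_group J \<Longrightarrow> g ** h = mat 1 \<Longrightarrow> h \<in> symplectic_group J"
  unfolding mem_symplectic_group_iff by (metis matrix_vector_mul_assoc matrix_vector_mul_lid)

lemma gen_group_least:
  assumes "mat 1 \<in> H" "A \<subseteq> H" "\<And>a b. a \<in> H \<Longrightarrow> b \<in> H \<Longrightarrow> a ** b \<in> H"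
    "\<And>a b. a \<in> H \<Longrightarrow> b ** a = mat 1 \<Longrightarrow> a ** b = mat 1 \<Longrightarrow> b \<in> H"
  shows "gen_group A \<subseteq> H"
proof
  fix x assume "x \<in> gen_group A" then show "x \<in> H"
    by (induct rule: gen_group.induct) (use assms in auto)
qed

lemma gen_group_subset_symplectic:
  "A \<subseteq> symplectic_group J \<Longrightarrow> gen_group A \<subseteq> symplectic_group J"
  by (rule gen_group_least)
    (use symplectic_group_one symplectic_group_mult symplectic_group_inverse in auto)

locale symplectic_space =
  fixes J :: "'a::field^'n^'n"
  assumes nondeg_alt: "nondeg_alternating J"
begin

lemma bform_self [simp]: "bform J x x = 0"
  using nondeg_alt unfolding nondeg_alternating_def by auto

lemma bform_skew: "bform J x y = - bform J y x"
proof -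
  have "bform J (x + y) (x + y) = 0" by simp
  then show ?thesis by (simp add: bform_add_left bform_add_right eq_neg_iff_add_eq_0 add.commute)
qed

lemma bform_nondeg_right: "x \<noteq> 0 \<Longrightarrow> \<exists>y. bform J x y \<noteq> 0"
  using nondeg_alt unfolding nondeg_alternating_def by auto

lemma bform_nondeg_left: "x \<noteq> 0 \<Longrightarrow> \<exists>u. bform J u x \<noteq> 0"
  by (metis bform_nondeg_right bform_skew)

lemma bform_nondeg_on_spanning:
  assumes "vec.span S = UNIV" and "x \<noteq> 0"
  shows "\<exists>s\<in>S. bform J x s \<noteq> 0"
proof (rule ccontr)
  assume "\<not> ?thesis"
  then have "fapp (x v* J) s = 0" if "s \<in> S" for s
    using that by (simp add: fapp_vector_matrix_mult)
  then have "bform J x y = 0" for y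
    using fapp_eq_0_on_span[of y S "x v* J"] assms(1) by (simp add: fapp_vector_matrix_mult)
  then show False
    using assms(2) bform_nondeg_right by blast
qed

lemma symp_transv_symplectic: "symp_transv J u c \<in> symplectic_group J"
  unfolding mem_symplectic_group_iff symp_transv_apply
proof (intro allI)
  fix x y
  show "bform J (x + (c * bform J u x) *s u) (y + (c * bform J u y) *s u) = bform J x y"
    by (simp add: bform_add_left bform_add_right bform_scale_left bform_scale_right
        bform_skew[of x u] algebra_simps)
qed

lemma symp_transv_add: "symp_transv J u a ** symp_transv J u b = symp_transv J u (a + b)"
  by (simp add: matrix_eq matrix_vector_mul_assoc[symmetric] symp_transv_apply bform_add_right
      bform_scale_right algebra_simps)

lemma symp_transv_inverse:
  "symp_transv J u (- c) ** symp_transv J u c = mat 1"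
  "symp_transv J u c ** symp_transv J u (- c) = mat 1"
  by (simp_all add: symp_transv_add)

lemma symp_transv_conjugate:
  assumes g: "g \<in> symplectic_group J" and gh: "g ** h = mat 1"
  shows "g ** symp_transv J u c ** h = symp_transv J (g *v u) c"
proof -
  have "bform J u (h *v z) = bform J (g *v u) z" for z
    using g gh unfolding mem_symplectic_group_iff
    by (metis matrix_vector_mul_assoc matrix_vector_mul_lid)
  then show ?thesis
    using gh by (simp add: matrix_eq symp_transv_apply matrix_vector_mul_assoc[symmetric]
        matrix_vector_right_distrib vector_scalar_commute)
qed

end

context symplectic_space
begin

lemma fixed_space_grows_by_one_transv:
  assumes g: "g \<in> symplectic_group J" and nz: "bform J x (g *v x) \<noteq> 0"
  shows "{z. g *v z = z}
    \<subset> {z. (symp_transv J (g *v x - x) (1 / bform J x (g *v x)) ** g) *v z = z}"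
proof -
  let ?h = "symp_transv J (g *v x - x) (1 / bform J x (g *v x)) ** g"
  have "bform J (g *v x - x) (g *v x) = - bform J x (g *v x)"
    by (simp add: bform_diff_left)
  then have "?h *v x = x"
    using nz by (simp add: matrix_vector_mul_assoc[symmetric] symp_transv_apply)
  moreover have "g *v x \<noteq> x"
    using nz by auto
  moreover have "?h *v z = z" if "g *v z = z" for z
  proof -
    have "bform J (g *v x - x) z = 0"
      using g that unfolding mem_symplectic_group_iff by (metis bform_diff_left diff_self)
    then show ?thesis
      using that by (simp add: matrix_vector_mul_assoc[symmetric] symp_transv_apply)
  qed
  ultimately show ?thesis by blast
qed

lemma transv_breaks_isotropy:
  assumes g: "g \<in> symplectic_group J" and g1: "g \<noteq> mat 1"
    and isotropic: "\<And>x. bform J x (g *v x) = 0"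
  obtains y x where "bform J x ((symp_transv J y 1 ** g) *v x) \<noteq> 0"
    and "{z. g *v z = z} \<subseteq> {z. (symp_transv J y 1 ** g) *v z = z}"
proof -
  obtain x0 where x0: "g *v x0 \<noteq> x0"
    using g1 by (metis matrix_eq matrix_vector_mul_lid)
  define y where "y = g *v x0 - x0"
  obtain x where yx: "bform J y x \<noteq> 0"
    using x0 bform_nondeg_right unfolding y_def by fastforce
  have g_isometry: "bform J (g *v a) (g *v b) = bform J a b" for a b
    using g unfolding mem_symplectic_group_iff by blast
  have "bform J x0 (g *v x) = - bform J x (g *v x0)"
    using isotropic[of "x0 + x"] isotropic[of x0] isotropic[of x]
    by (simp add: bform_add_left bform_add_right matrix_vector_right_distrib eq_neg_iff_add_eq_0)
      (metis add.commute)
  then have y_gx: "bform J y (g *v x) = bform J x y"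
    unfolding y_def bform_diff_left bform_diff_right g_isometry
    using bform_skew[of x0 x] by simp
  have "bform J x ((symp_transv J y 1 ** g) *v x) = bform J x y * bform J x y"
    by (simp add: matrix_vector_mul_assoc[symmetric] symp_transv_apply bform_add_right
        bform_scale_right y_gx isotropic)
  moreover have "bform J x y \<noteq> 0"
    using yx bform_skew[of y x] by simp
  ultimately have "bform J x ((symp_transv J y 1 ** g) *v x) \<noteq> 0"
    by simp
  moreover have "bform J y z = 0" if "g *v z = z" for z
    using g_isometry[of x0 z] that by (simp add: y_def bform_diff_left)
  then have "{z. g *v z = z} \<subseteq> {z. (symp_transv J y 1 ** g) *v z = z}"
    by (auto simp: matrix_vector_mul_assoc[symmetric] symp_transv_apply)
  ultimately show ?thesis
    by (rule that)
qed

lemma fixed_space_grows: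
  assumes g: "g \<in> symplectic_group J" and g1: "g \<noteq> mat 1"
  shows "\<exists>u1 c1 u2 c2. {z. g *v z = z}
    \<subset> {z. (symp_transv J u2 c2 ** symp_transv J u1 c1 ** g) *v z = z}"
proof (cases "\<exists>x. bform J x (g *v x) \<noteq> 0")
  case True
  then obtain x where "bform J x (g *v x) \<noteq> 0" by blast
  then have "{z. g *v z = z} \<subset> {z. (symp_transv J (g *v x - x) (1 / bform J x (g *v x))
      ** symp_transv J 0 0 ** g) *v z = z}"
    using fixed_space_grows_by_one_transv[OF g] by simp
  then show ?thesis by blast
next
  case False
  \<comment> \<open>Every x is orthogonal to g x: one transvection in the direction of a displacement
    g x0 - x0 produces an element h with some x not orthogonal to h x.\<close>
  then obtain y x where hx: "bform J x ((symp_transv J y 1 ** g) *v x) \<noteq> 0"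
    and fixed: "{z. g *v z = z} \<subseteq> {z. (symp_transv J y 1 ** g) *v z = z}"
    using transv_breaks_isotropy[OF g g1] by blast
  define h where "h = symp_transv J y 1 ** g"
  have h: "h \<in> symplectic_group J"
    unfolding h_def by (rule symplectic_group_mult[OF symp_transv_symplectic g])
  have "{z. g *v z = z} \<subseteq> {z. h *v z = z}"
    using fixed unfolding h_def .
  also have "\<dots> \<subset> {z. (symp_transv J (h *v x - x) (1 / bform J x (h *v x)) ** h) *v z = z}"
    using fixed_space_grows_by_one_transv[OF h] hx unfolding h_def by blast
  finally show ?thesis
    unfolding h_def matrix_mul_assoc by blast
qed

theorem symplectic_group_generated:
  assumes one: "mat 1 \<in> H" and transv: "\<And>u c. symp_transv J u c \<in> H"
    and mult: "\<And>a b. a \<in> H \<Longrightarrow> b \<in> H \<Longrightarrow> a ** b \<in> H"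
  shows "symplectic_group J \<subseteq> H"
proof
  fix g :: "'a^'n^'n"
  assume "g \<in> symplectic_group J"
  then show "g \<in> H"
  proof (induction "CARD('n) - vec.dim {z. g *v z = z}" arbitrary: g rule: less_induct)
    case less
    show ?case
    proof (cases "g = mat 1")
      case True
      then show ?thesis using one by simp
    next
      case False
      then obtain u1 c1 u2 c2 where grow: "{z. g *v z = z}
          \<subset> {z. (symp_transv J u2 c2 ** symp_transv J u1 c1 ** g) *v z = z}"
        using fixed_space_grows[OF less.prems] by blast
      define h where "h = symp_transv J u2 c2 ** symp_transv J u1 c1 ** g"
      have h: "h \<in> symplectic_group J"
        unfolding h_def by (intro symplectic_group_mult symp_transv_symplectic less.prems)
      have fixed_subspace: "vec.subspace {z. f *v z = z}" for f :: "'a^'n^'n"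
        by (auto simp: vec.subspace_def matrix_vector_right_distrib vector_scalar_commute)
      have "vec.dim {z. g *v z = z} < vec.dim {z. h *v z = z}"
        using grow unfolding h_def
        by (intro vec.dim_psubset) (simp add: vec.span_eq_iff[THEN iffD2, OF fixed_subspace])
      moreover have "vec.dim {z. h *v z = z} \<le> CARD('n)"
        using vec.dim_subset_UNIV by (simp add: vec.dimension_def card_cart_basis)
      ultimately have "h \<in> H"
        using less.hyps[OF _ h] by simp
      moreover have "g = symp_transv J u1 (- c1) ** (symp_transv J u2 (- c2) ** h)"
        unfolding h_def by (simp add: matrix_mul_assoc symp_transv_inverse)
      ultimately show ?thesis
        using transv mult by metis
    qed
  qed
qed

lemma symp_transv_conjugate_shift:
  assumes "bform J w x \<noteq> 0"
  shows "symp_transv J w (t / bform J w x) ** symp_transv J x c ** symp_transv J w (- (t / bform J w x))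
    = symp_transv J (x + t *s w) c"
proof -
  have "symp_transv J w (t / bform J w x) *v x = x + t *s w"
    using assms by (simp add: symp_transv_apply)
  then show ?thesis
    using symp_transv_conjugate[OF symp_transv_symplectic symp_transv_inverse(2)] by metis
qed

end

section \<open>Generation by transvections along a connected family\<close>

lemma exists_avoiding_two:
  assumes "\<exists>c::'a::field. c \<noteq> 0 \<and> c \<noteq> 1"
  shows "\<exists>t::'a. t \<noteq> a \<and> t \<noteq> b"
  using assms by (metis zero_neq_one)

text \<open>D is meant to be the set of directions u all of whose symplectic transvections lie in a
  given group.\<close>

locale transvection_directions = symplectic_space J for J :: "'a::field^'n^'n" +
  fixes D :: "('a^'n) set"
  assumes field_not_F2: "\<exists>c::'a. c \<noteq> 0 \<and> c \<noteq> 1"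
    and zero_notin: "0 \<notin> D"
    and scale_closed: "x \<in> D \<Longrightarrow> s \<noteq> 0 \<Longrightarrow> s *s x \<in> D"
    and shift_closed: "x \<in> D \<Longrightarrow> w \<in> D \<Longrightarrow> bform J w x \<noteq> 0 \<Longrightarrow> x + t *s w \<in> D"
    and spanning: "vec.span D = UNIV"
    and connected: "R \<subseteq> D \<Longrightarrow> R \<noteq> {} \<Longrightarrow>
      (\<And>e e'. e \<in> R \<Longrightarrow> e' \<in> D \<Longrightarrow> bform J e e' \<noteq> 0 \<Longrightarrow> e' \<in> R) \<Longrightarrow> D \<subseteq> R"
begin

lemma exists_nonorthogonal: "p \<noteq> 0 \<Longrightarrow> \<exists>z\<in>D. bform J z p \<noteq> 0"
  using bform_nondeg_on_spanning[OF spanning] bform_skew by (metis neg_equal_0_iff_equal)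

lemma shift_values: "bform J (z + t *s w) y = bform J z y + t * bform J w y"
  by (simp add: bform_add_left bform_scale_left)

lemma orthogonality_propagates:
  assumes bad: "\<forall>z\<in>D. bform J z p = 0 \<or> bform J z q = 0 \<or> bform J z r = 0"
    and sum: "p + q + r = 0"
    and z: "z \<in> D" "bform J z p = 0" "bform J z q \<noteq> 0" "bform J z r \<noteq> 0"
    and w: "w \<in> D" "bform J w z \<noteq> 0"
  shows "bform J w p = 0"
proof (rule ccontr)
  assume wp: "bform J w p \<noteq> 0"
  have sum_values: "bform J u p + bform J u q + bform J u r = 0" for u
    using bform_sum_zero[OF sum] .
  \<comment> \<open>If w is orthogonal to q, then z + t w is orthogonal to none of p, q, r for every t
    avoiding 0 and one further value; this is where |K| > 2 is needed.\<close>
  have w_orth_impossible: False if "bform J w q = 0" "bform J z q \<noteq> 0" "bform J z r \<noteq> 0"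
    "\<And>u. bform J u p + bform J u q + bform J u r = 0"
    "\<forall>z\<in>D. bform J z p = 0 \<or> bform J z q = 0 \<or> bform J z r = 0" for q r
  proof -
    have wr: "bform J w r \<noteq> 0"
      using that(1) that(4)[of w] wp by (metis add.right_neutral)
    obtain t where t: "t \<noteq> 0" "t \<noteq> - bform J z r / bform J w r"
      using exists_avoiding_two[OF field_not_F2] by blast
    have "bform J z r + t * bform J w r \<noteq> 0"
      using t(2) wr by (auto simp: field_simps add_eq_0_iff2)
    then have "bform J (z + t *s w) r \<noteq> 0"
      by (simp add: shift_values)
    moreover have "bform J (z + t *s w) p \<noteq> 0" "bform J (z + t *s w) q \<noteq> 0"
      using t(1) wp z(2) that(1,2) by (simp_all add: shift_values)
    moreover have "z + t *s w \<in> D"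
      using shift_closed[OF z(1) w] .
    ultimately show False
      using that(5) by blast
  qed
  have "bform J w q = 0 \<or> bform J w r = 0"
    using bad w(1) wp by blast
  then show False
  proof
    assume "bform J w q = 0"
    then show False
      by (rule w_orth_impossible[of q r]) (use bad z sum_values in auto)
  next
    assume "bform J w r = 0"
    then show False
      by (rule w_orth_impossible[of r q]) (use bad z sum_values in \<open>auto simp: add_ac\<close>)
  qed
qed

lemma nonorthogonal_witness_shift:
  assumes sum: "p + q + r = 0"
    and z: "z \<in> D" "bform J z p = 0" "bform J z q \<noteq> 0" "bform J z r \<noteq> 0"
    and e: "e \<in> D" "bform J z e \<noteq> 0" "bform J e p = 0" "bform J e q = 0 \<or> bform J e r = 0"
    and e': "bform J e e' \<noteq> 0"
  obtains z' where "z' \<in> D" "bform J z' p = 0" "bform J z' q \<noteq> 0" "bform J z' r \<noteq> 0"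
    "bform J z' e' \<noteq> 0"
proof -
  have "bform J e q = 0" "bform J e r = 0"
    using bform_sum_zero[OF sum, of J e] e(3,4) by auto
  moreover define s where "s = (if bform J z e' = 0 then 1 else (0::'a))"
  moreover have "z + s *s e \<in> D"
    using shift_closed[OF z(1) e(1)] e(2) bform_skew[of z e] by simp
  moreover have "bform J (z + s *s e) e' \<noteq> 0"
    using e' unfolding shift_values s_def by auto
  ultimately show ?thesis
    using that z e(3) by (simp add: shift_values)
qed

lemma orthogonal_everywhere:
  assumes bad: "\<forall>z\<in>D. bform J z p = 0 \<or> bform J z q = 0 \<or> bform J z r = 0"
    and sum: "p + q + r = 0"
    and z0: "z0 \<in> D" "bform J z0 p = 0" "bform J z0 q \<noteq> 0" "bform J z0 r \<noteq> 0"
  shows "\<forall>e\<in>D. bform J e p = 0"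
proof -
  define Z where "Z = {z\<in>D. bform J z p = 0 \<and> bform J z q \<noteq> 0 \<and> bform J z r \<noteq> 0}"
  define R where "R = {e\<in>D. \<exists>z\<in>Z. z = e \<or> bform J z e \<noteq> 0}"
  have R_orth: "bform J e p = 0" if eR: "e \<in> R" for e
  proof -
    obtain z where z: "z \<in> Z" "z = e \<or> bform J z e \<noteq> 0" and e: "e \<in> D"
      using eR unfolding R_def by blast
    show ?thesis
    proof (cases "z = e")
      case True
      then show ?thesis using z unfolding Z_def by blast
    next
      case False
      then have "bform J e z \<noteq> 0"
        using z(2) bform_skew[of z e] by simp
      then show ?thesis
        using orthogonality_propagates[OF bad sum _ _ _ _ e] z(1) unfolding Z_def by blast
    qed
  qed
  have "D \<subseteq> R"
  proof (rule connected)
    show "R \<subseteq> D" "R \<noteq> {}"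
      using z0 unfolding R_def Z_def by auto
  next
    fix e e' assume eR: "e \<in> R" and e': "e' \<in> D" and ee': "bform J e e' \<noteq> 0"
    show "e' \<in> R"
    proof (cases "e \<in> Z")
      case True
      then show ?thesis using e' ee' unfolding R_def by blast
    next
      case False
      obtain z where z: "z \<in> Z" "z = e \<or> bform J z e \<noteq> 0"
        using eR unfolding R_def by blast
      have "bform J e p = 0" "e \<in> D" "bform J z e \<noteq> 0"
        using R_orth eR z False unfolding R_def by auto
      moreover have "bform J e q = 0 \<or> bform J e r = 0"
        using False calculation unfolding Z_def by blast
      ultimately obtain z' where "z' \<in> Z" "bform J z' e' \<noteq> 0"
        using nonorthogonal_witness_shift[OF sum, of z e e'] z(1) ee' unfolding Z_def by blast
      then show ?thesis
        using e' unfolding R_def by blast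
    qed
  qed
  then show ?thesis
    using R_orth by blast
qed

lemma exists_nonorthogonal_to_triple:
  assumes p: "p \<noteq> 0" and q: "q \<noteq> 0" and r: "r \<noteq> 0" and sum: "p + q + r = 0"
  shows "\<exists>z\<in>D. bform J z p \<noteq> 0 \<and> bform J z q \<noteq> 0 \<and> bform J z r \<noteq> 0"
proof (rule ccontr)
  assume "\<not> ?thesis"
  then have bad: "\<forall>z\<in>D. bform J z p = 0 \<or> bform J z q = 0 \<or> bform J z r = 0"
    by blast
  obtain z where z: "z \<in> D" "bform J z p \<noteq> 0"
    using exists_nonorthogonal[OF p] by blast
  have "bform J z p + bform J z q + bform J z r = 0"
    using bform_sum_zero[OF sum] .
  then consider "bform J z q = 0" "bform J z r \<noteq> 0" | "bform J z r = 0" "bform J z q \<noteq> 0"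
    using bad z by fastforce
  then show False
  proof cases
    case 1
    have "\<forall>e\<in>D. bform J e q = 0"
      by (rule orthogonal_everywhere[of q p r z])
        (use bad sum z 1 in \<open>auto simp: add_ac\<close>)
    then show False using exists_nonorthogonal[OF q] by blast
  next
    case 2
    have "\<forall>e\<in>D. bform J e r = 0"
      by (rule orthogonal_everywhere[of r p q z])
        (use bad sum z 2 in \<open>auto simp: add_ac\<close>)
    then show False using exists_nonorthogonal[OF r] by blast
  qed
qed

lemma add_closed:
  assumes x: "x \<in> D" and y: "y \<in> D" and xy: "x + y \<noteq> 0"
  shows "x + y \<in> D"
proof (cases "bform J y x = 0")
  case False
  then show ?thesis using shift_closed[OF x y, of 1] by simp
next
  case True
  have "x \<noteq> 0" "y \<noteq> 0" "- (x + y) \<noteq> 0" "x + y + - (x + y) = 0"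
    using x y xy zero_notin by auto
  moreover have "bform J z (- (x + y)) = - bform J z (x + y)" for z
    using bform_scale_right[of J z "-1" "x + y"] by simp
  ultimately obtain z where z: "z \<in> D" "bform J z x \<noteq> 0" "bform J z y \<noteq> 0"
    "bform J z (x + y) \<noteq> 0"
    using exists_nonorthogonal_to_triple[of x y "- (x + y)"] by auto
  have "x + 1 *s z \<in> D" "y + (-1) *s z \<in> D"
    using shift_closed[OF x z(1,2)] shift_closed[OF y z(1,3)] by blast+
  moreover have "bform J (y + (-1) *s z) (x + 1 *s z) = - bform J z (x + y)"
    using True bform_skew[of y z]
    by (simp add: bform_add_left bform_add_right bform_diff_left bform_scale_left bform_scale_right)
  ultimately show ?thesis
    using shift_closed[of "x + 1 *s z" "y + (-1) *s z" 1] z(4) by simp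
qed

theorem nonzero_in_directions: "x \<noteq> 0 \<Longrightarrow> x \<in> D"
proof -
  have "vec.subspace (insert 0 D)"
    using add_closed scale_closed unfolding vec.subspace_def
    by auto
  then have "vec.span D \<subseteq> insert 0 D"
    by (intro vec.span_minimal) auto
  then show "x \<noteq> 0 \<Longrightarrow> x \<in> D" using spanning by auto
qed

end

context symplectic_space
begin

lemma nonorthogonal_closure_covers:
  fixes v :: "'i \<Rightarrow> 'a^'n"
  assumes span: "vec.span (v ` I) = UNIV"
    and conn: "\<And>a b. a \<in> I \<Longrightarrow> b \<in> I \<Longrightarrow>
      (a, b) \<in> {(a, b). a \<in> I \<and> b \<in> I \<and> bform J (v a) (v b) \<noteq> 0}\<^sup>*"
    and vD: "\<And>a. a \<in> I \<Longrightarrow> v a \<in> D" and r: "r \<in> R" "r \<noteq> 0"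
    and closed: "\<And>e e'. e \<in> R \<Longrightarrow> e' \<in> D \<Longrightarrow> bform J e e' \<noteq> 0 \<Longrightarrow> e' \<in> R"
  shows "D - {0} \<subseteq> R"
proof
  obtain a where a: "a \<in> I" "bform J r (v a) \<noteq> 0"
    using bform_nondeg_on_spanning[OF span r(2)] by blast
  have "v b \<in> R" if "b \<in> I" for b
    using conn[OF a(1) that]
  proof (induction rule: rtrancl_induct)
    case base
    then show ?case using closed[OF r(1) vD a(2)] a(1) by blast
  next
    case (step b c)
    then show ?case using closed vD by blast
  qed
  moreover fix d assume d: "d \<in> D - {0}"
  then obtain b where "b \<in> I" "bform J d (v b) \<noteq> 0"
    using bform_nondeg_on_spanning[OF span] by blast
  ultimately show "d \<in> R"
    using closed d bform_skew[of d "v b"] by (metis DiffD1 neg_equal_0_iff_equal)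
qed

theorem symp_transv_family_generates:
  fixes v :: "'i \<Rightarrow> 'a^'n"
  assumes field_not_F2: "\<exists>c::'a. c \<noteq> 0 \<and> c \<noteq> 1"
    and span: "vec.span (v ` I) = UNIV" and nonzero: "\<And>a. a \<in> I \<Longrightarrow> v a \<noteq> 0"
    and conn: "\<And>a b. a \<in> I \<Longrightarrow> b \<in> I \<Longrightarrow>
      (a, b) \<in> {(a, b). a \<in> I \<and> b \<in> I \<and> bform J (v a) (v b) \<noteq> 0}\<^sup>*"
  shows "gen_group {symp_transv J (v a) mu | mu a. a \<in> I} = symplectic_group J"
proof
  define G where "G = gen_group {symp_transv J (v a) mu | mu a. a \<in> I}"
  show "G \<subseteq> symplectic_group J"
    unfolding G_def by (rule gen_group_subset_symplectic) (auto intro: symp_transv_symplectic)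
  define D where "D = {x. x \<noteq> 0 \<and> (\<forall>mu. symp_transv J x mu \<in> G)}"
  have vD: "v a \<in> D" if "a \<in> I" for a
    using that nonzero unfolding D_def G_def by (blast intro: gg_gen)
  interpret transvection_directions J D
  proof
    show "\<exists>c::'a. c \<noteq> 0 \<and> c \<noteq> 1" "0 \<notin> D"
      using field_not_F2 unfolding D_def by auto
    show "s *s x \<in> D" if "x \<in> D" "s \<noteq> 0" for x s
      using that unfolding D_def by (simp add: symp_transv_scale)
    show "x + t *s w \<in> D" if x: "x \<in> D" and w: "w \<in> D" and wx: "bform J w x \<noteq> 0" for x w t
    proof -
      have "x + t *s w \<noteq> 0"
        using wx by (metis add.commute bform_add_right bform_scale_right bform_self
            bform_zero_right add_0)
      moreover have "symp_transv J (x + t *s w) nu \<in> G" for nu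
        using x w symp_transv_conjugate_shift[OF wx, of t nu, symmetric]
        unfolding D_def G_def by (auto intro!: gg_mult)
      ultimately show ?thesis unfolding D_def by blast
    qed
    show "vec.span D = UNIV"
      using span vD vec.span_mono[of "v ` I" D] by auto
    show "D \<subseteq> R" if RD: "R \<subseteq> D" and "R \<noteq> {}"
      and closed: "\<And>e e'. e \<in> R \<Longrightarrow> e' \<in> D \<Longrightarrow> bform J e e' \<noteq> 0 \<Longrightarrow> e' \<in> R" for R
    proof -
      obtain r where "r \<in> R" "r \<noteq> 0"
        using RD \<open>R \<noteq> {}\<close> unfolding D_def by blast
      with span conn vD have "D - {0} \<subseteq> R"
        using closed by (rule nonorthogonal_closure_covers)
      then show ?thesis
        unfolding D_def by blast
    qed
  qed
  have "symp_transv J u mu \<in> G" for u mu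
    using nonzero_in_directions[of u] gg_one unfolding D_def G_def by (cases "u = 0") auto
  then show "symplectic_group J \<subseteq> G"
    by (intro symplectic_group_generated) (auto simp: G_def intro: gg_one gg_mult)
qed

end

section \<open>Necessity of the conditions\<close>

inductive_set gen_monoid :: "('a::field^'n^'n) set \<Rightarrow> ('a^'n^'n) set" for A where
  gen_monoid_one: "mat 1 \<in> gen_monoid A"
| gen_monoid_step: "a \<in> A \<Longrightarrow> m \<in> gen_monoid A \<Longrightarrow> a ** m \<in> gen_monoid A"

lemma gen_monoid_mult: "m \<in> gen_monoid A \<Longrightarrow> m' \<in> gen_monoid A \<Longrightarrow> m ** m' \<in> gen_monoid A"
  by (induct rule: gen_monoid.induct) (auto simp: matrix_mul_assoc[symmetric] intro: gen_monoid_step)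

lemma gen_monoid_inverse:
  assumes inv: "\<And>a. a \<in> A \<Longrightarrow> \<exists>a'\<in>A. a' ** a = mat 1 \<and> a ** a' = mat 1"
  shows "m \<in> gen_monoid A \<Longrightarrow> \<exists>m'\<in>gen_monoid A. m' ** m = mat 1 \<and> m ** m' = mat 1"
proof (induct rule: gen_monoid.induct)
  case gen_monoid_one
  then show ?case by (intro bexI[of _ "mat 1"]) (auto intro: gen_monoid.gen_monoid_one)
next
  case (gen_monoid_step a m)
  obtain a' where a': "a' \<in> A" "a' ** a = mat 1" "a ** a' = mat 1"
    using inv[OF gen_monoid_step(1)] by blast
  obtain m' where m': "m' \<in> gen_monoid A" "m' ** m = mat 1" "m ** m' = mat 1"
    using gen_monoid_step(3) by blast
  have "(m' ** a') ** (a ** m) = mat 1" "(a ** m) ** (m' ** a') = mat 1"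
    by (metis a'(2) m'(2) matrix_mul_assoc matrix_mul_lid)
      (metis a'(3) m'(3) matrix_mul_assoc matrix_mul_lid)
  moreover have "m' ** a' \<in> gen_monoid A"
    using gen_monoid_mult[OF m'(1)] gen_monoid.gen_monoid_step[OF a'(1) gen_monoid.gen_monoid_one] by simp
  ultimately show ?case by blast
qed

lemma gen_group_subset_gen_monoid:
  assumes inv: "\<And>a. a \<in> A \<Longrightarrow> \<exists>a'\<in>A. a' ** a = mat 1 \<and> a ** a' = mat 1"
  shows "gen_group A \<subseteq> gen_monoid A"
proof (rule gen_group_least)
  show "mat 1 \<in> gen_monoid A" "A \<subseteq> gen_monoid A"
    using gen_monoid_step[OF _ gen_monoid_one] by (auto intro: gen_monoid_one)
  show "a ** b \<in> gen_monoid A" if "a \<in> gen_monoid A" "b \<in> gen_monoid A" for a b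
    using that by (rule gen_monoid_mult)
  show "b \<in> gen_monoid A" if a: "a \<in> gen_monoid A" and "b ** a = mat 1" "a ** b = mat 1" for a b
  proof -
    obtain a' where "a' \<in> gen_monoid A" "a' ** a = mat 1"
      using gen_monoid_inverse[OF inv a] by blast
    moreover have "b = a'"
      by (metis \<open>a ** b = mat 1\<close> calculation(2) matrix_mul_assoc matrix_mul_lid matrix_mul_rid)
    ultimately show ?thesis by simp
  qed
qed

lemma gen_group_displacement:
  assumes inv: "\<And>a. a \<in> A \<Longrightarrow> \<exists>a'\<in>A. a' ** a = mat 1 \<and> a ** a' = mat 1"
    and W: "vec.subspace W" and N: "vec.subspace N" and WN: "W \<subseteq> N"
    and moves: "\<And>a x. a \<in> A \<Longrightarrow> x \<in> N \<Longrightarrow> a *v x - x \<in> W"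
    and g: "g \<in> gen_group A" and x: "x \<in> N"
  shows "g *v x - x \<in> W"
proof -
  have "g \<in> gen_monoid A"
    using g gen_group_subset_gen_monoid[OF inv] by blast
  then show ?thesis
    using x
  proof (induction arbitrary: x rule: gen_monoid.induct)
    case gen_monoid_one
    then show ?case using vec.subspace_0[OF W] by simp
  next
    case (gen_monoid_step a m)
    have "m *v x = x + (m *v x - x)"
      by simp
    then have "m *v x \<in> N"
      using gen_monoid_step WN vec.subspace_add[OF N] by (metis subsetD)
    then have "(a *v (m *v x) - m *v x) + (m *v x - x) \<in> W"
      using moves gen_monoid_step vec.subspace_add[OF W] by blast
    moreover have "(a ** m) *v x - x = (a *v (m *v x) - m *v x) + (m *v x - x)"
      by (simp add: matrix_vector_mul_assoc[symmetric])
    ultimately show ?case by simp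
  qed
qed

lemma SK_inverse_closed:
  assumes td: "\<forall>a\<in>I. is_transvection_data (v a) (phi a)" and g: "g \<in> SK I v phi"
  shows "\<exists>g'\<in>SK I v phi. g' ** g = mat 1 \<and> g ** g' = mat 1"
proof -
  obtain lam a where g: "g = transv (lam *s v a) (phi a)" and a: "a \<in> I"
    using g unfolding SK_def by blast
  have z: "fapp (phi a) (v a) = 0"
    using td a unfolding is_transvection_data_def by auto
  moreover have "transv (0 *s v a) (phi a) = mat 1"
    by (simp add: matrix_eq transv_apply)
  ultimately have "transv ((- lam) *s v a) (phi a) ** g = mat 1" "g ** transv ((- lam) *s v a) (phi a) = mat 1"
    unfolding g transv_add[OF z] by simp_all
  moreover have "transv ((- lam) *s v a) (phi a) \<in> SK I v phi"
    unfolding SK_def using a by blast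
  ultimately show ?thesis by blast
qed

lemma exists_annihilated_vector:
  fixes S :: "('a::field^'n) set"
  assumes "vec.span S \<noteq> UNIV"
  shows "\<exists>z. z \<noteq> 0 \<and> (\<forall>p\<in>S. fapp p z = 0)"
proof -
  obtain q where q: "q \<notin> vec.span S" using assms by blast
  obtain B where B: "B \<subseteq> vec.span S" "vec.independent B" "vec.span S \<subseteq> vec.span B"
    using vec.maximal_independent_subset by blast
  have span_B: "vec.span B = vec.span S"
    using B by (metis subset_antisym vec.span_minimal vec.subspace_span)
  have indep: "vec.independent (insert q B)"
    using B(2) q span_B by (simp add: vec.independent_insert)
  fix k :: 'n
  \<comment> \<open>a linear map killing span S but not q; z is its k-th row\<close>
  define L where "L = vec.construct (insert q B) (\<lambda>b. if b = q then axis k (1::'a) else 0)"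
  have lin: "Vector_Spaces.linear (*s) (*s) L"
    unfolding L_def by (rule vec.linear_construct[OF indep])
  have Lq: "L q = axis k 1"
    unfolding L_def by (subst vec.construct_basis[OF indep]) auto
  have "L b = 0" if "b \<in> B" for b
    unfolding L_def using q span_B that by (subst vec.construct_basis[OF indep]) (auto intro: vec.span_base)
  then have L0: "L p = 0" if "p \<in> vec.span B" for p
    using vec.linear_eq_0_on_span[OF lin] that by blast
  define z where "z = matrix L $ k"
  have fz: "fapp p z = L p $ k" for p
  proof -
    have "L p = matrix L *v p"
      by (simp add: matrix_works[OF lin])
    then show ?thesis
      unfolding fapp_def z_def by (simp add: matrix_vector_mult_def mult.commute)
  qed
  have "z \<noteq> 0"
    using fz[of q] Lq by (auto simp: axis_def)
  moreover have "\<forall>p\<in>S. fapp p z = 0"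
    using fz L0 span_B vec.span_base[of _ S] by (metis zero_index)
  ultimately show ?thesis by blast
qed

lemma prod_lessThan_rotate:
  fixes k :: nat
  assumes "k \<ge> 1"
  shows "(\<Prod>i<k. h ((i + 1) mod k)) = (\<Prod>i<k. (h i :: 'a::comm_monoid_mult))"
proof -
  obtain m where k: "k = Suc m" using assms by (cases k) auto
  have "(\<Prod>i<Suc m. h ((i + 1) mod Suc m)) = (\<Prod>i<m. h (Suc i)) * h 0"
    by simp
  also have "\<dots> = (\<Prod>i<Suc m. h i)"
    by (metis mult.commute prod.lessThan_Suc_shift)
  finally show ?thesis unfolding k .
qed

context symplectic_space
begin

lemma displacements_span:
  assumes W: "vec.subspace W" and x: "x \<noteq> 0"
    and moves: "\<And>u. symp_transv J u 1 *v x - x \<in> W"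
  shows "W = UNIV"
proof -
  have in_W: "u \<in> W" if "bform J u x \<noteq> 0" for u
  proof -
    have "bform J u x *s u \<in> W"
      using moves[of u] by (simp add: symp_transv_apply)
    then have "(1 / bform J u x) *s (bform J u x *s u) \<in> W"
      by (rule vec.subspace_scale[OF W])
    then show ?thesis using that by (simp add:)
  qed
  obtain u0 where u0: "bform J u0 x \<noteq> 0"
    using bform_nondeg_left[OF x] by blast
  have "u \<in> W" for u
  proof (cases "bform J u x = 0")
    case True
    then have "u + u0 \<in> W"
      using in_W u0 by (simp add: bform_add_left)
    then have "(u + u0) - u0 \<in> W"
      using vec.subspace_diff[OF W] in_W[OF u0] by blast
    then show ?thesis by simp
  qed (use in_W in blast)
  then show ?thesis by blast
qed

lemma symplectic_transv_form:
  assumes sp: "transv d p \<in> symplectic_group J" and d: "d \<noteq> 0"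
  shows "\<exists>c. \<forall>x. fapp p x = c * bform J d x"
proof -
  obtain y where y: "bform J d y \<noteq> 0"
    using bform_nondeg_right[OF d] by blast
  have "fapp p x * bform J d y = fapp p y * bform J d x" for x
  proof -
    have "bform J (x + fapp p x *s d) (y + fapp p y *s d) = bform J x y"
      using sp unfolding mem_symplectic_group_iff transv_apply by blast
    then show ?thesis
      using bform_skew[of x d]
      by (simp add: bform_add_left bform_add_right bform_scale_left bform_scale_right algebra_simps)
  qed
  then have "fapp p x = fapp p y / bform J d y * bform J d x" for x
    using y by (simp add: field_simps)
  then show ?thesis by blast
qed

lemma symplectic_transvections_not_P3:
  assumes td: "\<forall>a\<in>I. is_transvection_data (v a) (phi a)"
    and sp: "\<forall>a\<in>I. transv (v a) (phi a) \<in> symplectic_group J"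
  shows "\<not> P3 I v phi"
proof
  have "\<forall>a\<in>I. \<exists>c. \<forall>x. fapp (phi a) x = c * bform J (v a) x"
    using symplectic_transv_form sp td unfolding is_transvection_data_def by blast
  then obtain c where c: "\<And>a x. a \<in> I \<Longrightarrow> fapp (phi a) x = c a * bform J (v a) x"
    by metis
  assume "P3 I v phi"
  then obtain cs where cyc: "nonsingular_cycle I v phi cs"
    unfolding P3_def by blast
  define k where "k = length cs"
  define f where "f i = cs ! i" for i
  define g where "g i = cs ! ((i + 1) mod k)" for i
  have k: "k \<ge> 3" and I: "set cs \<subseteq> I"
    using cyc unfolding nonsingular_cycle_def Let_def k_def by auto
  have fI: "f i \<in> I" if "i < k" for i
    using I that nth_mem unfolding f_def k_def by blast
  have gI: "g i \<in> I" for i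
  proof -
    have "(i + 1) mod k < length cs"
      using k unfolding k_def by (intro mod_less_divisor) linarith
    then show ?thesis
      using I nth_mem unfolding g_def k_def by blast
  qed
  define X where "X = (\<Prod>i<k. bform J (v (f i)) (v (g i)))"
  define C where "C = (\<Prod>i<k. c (f i))"
  have forward: "(\<Prod>i<k. fapp (phi (f i)) (v (g i))) = C * X"
    unfolding C_def X_def prod.distrib[symmetric] by (rule prod.cong) (auto simp: c fI)
  have backward: "(\<Prod>i<k. fapp (phi (g i)) (v (f i))) = C * ((-1) ^ k * X)"
  proof -
    have "(\<Prod>i<k. fapp (phi (g i)) (v (f i))) = (\<Prod>i<k. c (g i) * - bform J (v (f i)) (v (g i)))"
      by (rule prod.cong) (auto simp: c gI bform_skew[of "v (g _)"])
    also have "\<dots> = (\<Prod>i<k. c (g i)) * ((-1) ^ k * X)"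
      unfolding prod.distrib X_def prod_uminus by simp
    also have "(\<Prod>i<k. c (g i)) = C"
      unfolding g_def C_def f_def using prod_lessThan_rotate[of k "\<lambda>i. c (cs ! i)"] k by simp
    finally show ?thesis .
  qed
  have sign: "(-1::'a) ^ (k - 1) * (-1) ^ k = -1"
    using k by (cases k) (simp_all add: minus_one_power_iff)
  have "(\<Prod>i<k. fapp (phi (f i)) (v (g i)))
      + (-1) ^ (k - 1) * (\<Prod>i<k. fapp (phi (g i)) (v (f i))) = 0"
    unfolding forward backward using sign by (simp add: algebra_simps)
  then show False
    using cyc unfolding nonsingular_cycle_def Let_def f_def g_def k_def by auto
qed

context
  fixes I :: "'i set" and v phi :: "'i \<Rightarrow> 'a^'n"
  assumes td: "\<forall>a\<in>I. is_transvection_data (v a) (phi a)"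
    and gen: "gen_group (SK I v phi) = symplectic_group J"
begin

lemma generated_displacement_subspace:
  assumes W: "vec.subspace W" and N: "vec.subspace N" and WN: "W \<subseteq> N"
    and moves: "\<And>a x. a \<in> I \<Longrightarrow> x \<in> N \<Longrightarrow> fapp (phi a) x *s v a \<in> W"
    and x: "x \<in> N" "x \<noteq> 0"
  shows "W = UNIV"
proof (rule displacements_span[OF W x(2)])
  fix u
  have "g *v y - y \<in> W" if g: "g \<in> SK I v phi" and y: "y \<in> N" for g y
  proof -
    obtain lam a where g: "g = transv (lam *s v a) (phi a)" and a: "a \<in> I"
      using g unfolding SK_def by blast
    have "lam *s (fapp (phi a) y *s v a) \<in> W"
      using vec.subspace_scale[OF W moves[OF a y]] .
    then show ?thesis
      by (simp add: g transv_apply mult.commute)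
  qed
  moreover have "symp_transv J u 1 \<in> gen_group (SK I v phi)"
    using gen symp_transv_symplectic by blast
  ultimately show "symp_transv J u 1 *v x - x \<in> W"
    using gen_group_displacement[OF SK_inverse_closed[OF td] W N WN] x(1) by blast
qed

lemma generated_P1: "P1 I v phi"
  unfolding P1_def
proof
  show "vec.span (v ` I) = UNIV"
    by (rule generated_displacement_subspace[of _ UNIV 1])
      (auto intro: vec.span_scale vec.span_base)
  show "vec.span (phi ` I) = UNIV"
  proof (rule ccontr)
    assume "vec.span (phi ` I) \<noteq> UNIV"
    then obtain z where z: "z \<noteq> 0" "\<forall>p\<in>phi ` I. fapp p z = 0"
      using exists_annihilated_vector by blast
    have "{0} = (UNIV :: ('a^'n) set)"
    proof (rule generated_displacement_subspace[of _ "vec.span {z}" z])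
      show "fapp (phi a) x *s v a \<in> {0}" if "a \<in> I" "x \<in> vec.span {z}" for a x
        using that z(2) fapp_eq_0_on_span[of x "{z}" "phi a"] by simp
    qed (use z in \<open>auto simp: vec.span_zero vec.span_base\<close>)
    then show False
      by (metis one_neq_zero singletonD UNIV_I)
  qed
qed

lemma generated_P2: "P2 I v phi"
proof (rule ccontr)
  let ?t = "\<lambda>a. transv (v a) (phi a)"
  let ?E = "gamma_edge I v phi"
  assume "\<not> P2 I v phi"
  then obtain a1 b where a1: "a1 \<in> I" and b: "b \<in> I" "(?t a1, ?t b) \<notin> ?E\<^sup>*"
    unfolding P2_def by blast
  define A where "A = {a\<in>I. (?t a1, ?t a) \<in> ?E\<^sup>*}"
  define N where "N = {x. \<forall>b\<in>I - A. fapp (phi b) x = 0}"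
  have no_exit: "fapp (phi b) (v a) = 0" if "a \<in> A" "b \<in> I - A" for a b
  proof (rule ccontr)
    assume "fapp (phi b) (v a) \<noteq> 0"
    then have "(?t a, ?t b) \<in> ?E"
      using that td transv_neq_mat1 unfolding gamma_edge_def A_def by blast
    then show False
      using that unfolding A_def by (auto intro: rtrancl_into_rtrancl)
  qed
  have N: "vec.subspace N"
    unfolding N_def vec.subspace_def by (auto simp: fapp_add_right fapp_scale_right)
  have WN: "vec.span (v ` A) \<subseteq> N"
    by (rule vec.span_minimal[OF _ N]) (use no_exit in \<open>auto simp: N_def\<close>)
  have "vec.span (v ` A) = UNIV"
  proof (rule generated_displacement_subspace[OF vec.subspace_span N WN])
    show "fapp (phi a) x *s v a \<in> vec.span (v ` A)" if "a \<in> I" "x \<in> N" for a x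
      using that by (cases "a \<in> A") (auto simp: N_def vec.span_zero intro: vec.span_scale vec.span_base)
    show "v a1 \<in> N" "v a1 \<noteq> 0"
      using WN a1 td unfolding A_def is_transvection_data_def by (auto intro: vec.span_base)
  qed
  then have "fapp (phi b) x = 0" for x
    using WN b unfolding N_def A_def by blast
  then show False
    using td b(1) fapp_ext[of "phi b" 0] unfolding is_transvection_data_def by simp
qed

end

theorem generating_family_properties:
  assumes td: "\<forall>a\<in>I. is_transvection_data (v a) (phi a)"
    and gen: "gen_group (SK I v phi) = symplectic_group J"
  shows "P1 I v phi \<and> P2 I v phi \<and> \<not> P3 I v phi"
proof -
  have "transv (v a) (phi a) \<in> symplectic_group J" if "a \<in> I" for a
  proof -
    have "transv (1 *s v a) (phi a) \<in> gen_group (SK I v phi)"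
      unfolding SK_def using that by (blast intro: gen_group.gg_gen)
    then show ?thesis
      using gen by simp
  qed
  then show ?thesis
    using generated_P1[OF td gen] generated_P2[OF td gen] symplectic_transvections_not_P3[OF td]
    by blast
qed

end

section \<open>Walks in the graph and the potential\<close>

fun gamma_walk :: "'i set \<Rightarrow> ('i \<Rightarrow> 'a::field^'n) \<Rightarrow> ('i \<Rightarrow> 'a^'n) \<Rightarrow> 'i list \<Rightarrow> bool" where
  "gamma_walk I v phi (a # b # cs) \<longleftrightarrow>
     a \<in> I \<and> fapp (phi b) (v a) \<noteq> 0 \<and> gamma_walk I v phi (b # cs)"
| "gamma_walk I v phi [a] \<longleftrightarrow> a \<in> I"
| "gamma_walk I v phi [] \<longleftrightarrow> True"

fun walk_weight :: "('i \<Rightarrow> 'a::field^'n) \<Rightarrow> ('i \<Rightarrow> 'a^'n) \<Rightarrow> 'i list \<Rightarrow> 'a" where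
  "walk_weight v phi (a # b # cs) = fapp (phi b) (v a) * walk_weight v phi (b # cs)"
| "walk_weight v phi _ = 1"

fun walk_coweight :: "('i \<Rightarrow> 'a::field^'n) \<Rightarrow> ('i \<Rightarrow> 'a^'n) \<Rightarrow> 'i list \<Rightarrow> 'a" where
  "walk_coweight v phi (a # b # cs) = fapp (phi a) (v b) * walk_coweight v phi (b # cs)"
| "walk_coweight v phi _ = 1"

lemma walk_weight_append:
  "walk_weight v phi (xs @ y # ys) = walk_weight v phi (xs @ [y]) * walk_weight v phi (y # ys)"
  by (induction xs rule: induct_list012) auto

lemma walk_coweight_append:
  "walk_coweight v phi (xs @ y # ys) = walk_coweight v phi (xs @ [y]) * walk_coweight v phi (y # ys)"
  by (induction xs rule: induct_list012) auto

lemma gamma_walk_append: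
  "gamma_walk I v phi (xs @ y # ys) \<longleftrightarrow> gamma_walk I v phi (xs @ [y]) \<and> gamma_walk I v phi (y # ys)"
  by (induction xs rule: induct_list012) (auto elim: gamma_walk.elims)

lemma gamma_walk_subset: "gamma_walk I v phi xs \<Longrightarrow> set xs \<subseteq> I"
  by (induction xs rule: induct_list012) auto

lemma walk_weight_snoc:
  "xs \<noteq> [] \<Longrightarrow> walk_weight v phi (xs @ [y]) = walk_weight v phi xs * fapp (phi y) (v (last xs))"
  by (induction xs rule: induct_list012) auto

lemma walk_coweight_snoc:
  "xs \<noteq> [] \<Longrightarrow> walk_coweight v phi (xs @ [y]) = walk_coweight v phi xs * fapp (phi (last xs)) (v y)"
  by (induction xs rule: induct_list012) auto

lemma gamma_walk_snoc:
  "xs \<noteq> [] \<Longrightarrow> gamma_walk I v phi (xs @ [y]) \<longleftrightarrow>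
     gamma_walk I v phi xs \<and> y \<in> I \<and> fapp (phi y) (v (last xs)) \<noteq> 0"
  by (induction xs rule: induct_list012) auto

lemma walk_coweight_rev: "walk_coweight v phi (rev xs) = walk_weight v phi xs"
proof (induction xs rule: induct_list012)
  case (3 x y zs)
  have "walk_coweight v phi (rev (x # y # zs)) = walk_coweight v phi (rev (y # zs) @ [x])"
    by simp
  also have "\<dots> = walk_coweight v phi (rev (y # zs)) * fapp (phi y) (v x)"
    by (subst walk_coweight_snoc) auto
  finally show ?case
    using 3 by simp
qed auto

lemma walk_weight_nonzero: "gamma_walk I v phi xs \<Longrightarrow> walk_weight v phi xs \<noteq> 0"
  by (induction xs rule: induct_list012) auto

lemma walk_weight_nth:
  "walk_weight v phi xs = (\<Prod>i<length xs - 1. fapp (phi (xs ! Suc i)) (v (xs ! i)))"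
  by (induction xs rule: induct_list012) (simp_all add: prod.lessThan_Suc_shift del: prod.lessThan_Suc)

lemma walk_coweight_nth:
  "walk_coweight v phi xs = (\<Prod>i<length xs - 1. fapp (phi (xs ! i)) (v (xs ! Suc i)))"
  by (induction xs rule: induct_list012) (simp_all add: prod.lessThan_Suc_shift del: prod.lessThan_Suc)

lemma gamma_walk_nth:
  "gamma_walk I v phi xs \<Longrightarrow> i < length xs - 1 \<Longrightarrow> fapp (phi (xs ! Suc i)) (v (xs ! i)) \<noteq> 0"
proof (induction xs arbitrary: i rule: induct_list012)
  case (3 x y zs)
  then show ?case by (cases i) auto
qed auto

lemma walk_weight_splice:
  "walk_weight v phi (xs @ y # ys @ y # zs)
     = walk_weight v phi (y # ys @ [y]) * walk_weight v phi (xs @ y # zs)"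
  using walk_weight_append[of v phi xs y "ys @ y # zs"]
    walk_weight_append[of v phi "y # ys" y zs] walk_weight_append[of v phi xs y zs]
  by simp

lemma walk_coweight_splice:
  "walk_coweight v phi (xs @ y # ys @ y # zs)
     = walk_coweight v phi (y # ys @ [y]) * walk_coweight v phi (xs @ y # zs)"
  using walk_coweight_append[of v phi xs y "ys @ y # zs"]
    walk_coweight_append[of v phi "y # ys" y zs] walk_coweight_append[of v phi xs y zs]
  by simp

lemma gamma_walk_splice:
  "gamma_walk I v phi (xs @ y # ys @ y # zs)
     \<longleftrightarrow> gamma_walk I v phi (y # ys @ [y]) \<and> gamma_walk I v phi (xs @ y # zs)"
  using gamma_walk_append[of I v phi xs y "ys @ y # zs"]
    gamma_walk_append[of I v phi "y # ys" y zs] gamma_walk_append[of I v phi xs y zs]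
  by auto

lemma nth_close_cycle:
  assumes "i < length cs"
  shows "(cs @ [hd cs]) ! i = cs ! i" "(cs @ [hd cs]) ! Suc i = cs ! (Suc i mod length cs)"
proof -
  show "(cs @ [hd cs]) ! i = cs ! i"
    using assms by (simp add: nth_append)
  show "(cs @ [hd cs]) ! Suc i = cs ! (Suc i mod length cs)"
  proof (cases "Suc i < length cs")
    case False
    then have "Suc i = length cs" using assms by simp
    then show ?thesis using assms by (cases cs) (auto simp: nth_append)
  qed (simp add: nth_append)
qed

lemma simple_cycle_coweight:
  fixes v phi :: "'i \<Rightarrow> 'a::field^'n"
  assumes inj: "inj_on (\<lambda>a. transv (v a) (phi a)) I"
    and td: "\<forall>a\<in>I. is_transvection_data (v a) (phi a)" and not_P3: "\<not> P3 I v phi"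
    and cs: "distinct cs" "length cs \<ge> 3" and walk: "gamma_walk I v phi (cs @ [hd cs])"
  shows "walk_coweight v phi (cs @ [hd cs]) = (-1) ^ length cs * walk_weight v phi (cs @ [hd cs])"
proof -
  let ?k = "length cs" and ?t = "\<lambda>a. transv (v a) (phi a)"
  have I: "set cs \<subseteq> I"
    using gamma_walk_subset[OF walk] by auto
  have "distinct (map ?t cs)"
    using cs(1) inj_on_subset[OF inj I] by (simp add: distinct_map)
  moreover have "mat 1 \<notin> ?t ` set cs"
    using td I transv_neq_mat1 by fastforce
  moreover have "\<forall>i<?k. fapp (phi (cs ! ((i + 1) mod ?k))) (v (cs ! i)) \<noteq> 0"
    using gamma_walk_nth[OF walk] nth_close_cycle by fastforce
  ultimately have "(\<Prod>i<?k. fapp (phi (cs ! i)) (v (cs ! ((i + 1) mod ?k))))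
      + (-1) ^ (?k - 1) * (\<Prod>i<?k. fapp (phi (cs ! ((i + 1) mod ?k))) (v (cs ! i))) = 0"
    using not_P3 cs(2) I unfolding P3_def nonsingular_cycle_def Let_def by auto
  moreover have "walk_coweight v phi (cs @ [hd cs])
      = (\<Prod>i<?k. fapp (phi (cs ! i)) (v (cs ! ((i + 1) mod ?k))))"
    unfolding walk_coweight_nth by (rule prod.cong) (auto simp: nth_close_cycle)
  moreover have "walk_weight v phi (cs @ [hd cs])
      = (\<Prod>i<?k. fapp (phi (cs ! ((i + 1) mod ?k))) (v (cs ! i)))"
    unfolding walk_weight_nth by (rule prod.cong) (auto simp: nth_close_cycle)
  ultimately have "walk_coweight v phi (cs @ [hd cs])
      = - ((-1) ^ (?k - 1) * walk_weight v phi (cs @ [hd cs]))"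
    by (simp add: eq_neg_iff_add_eq_0)
  moreover have "(-1::'a) ^ ?k = - ((-1) ^ (?k - 1))"
    using cs(2) by (cases ?k) (simp_all add: minus_one_power_iff)
  ultimately show ?thesis
    by simp
qed

lemma cycle_coweight:
  fixes v phi :: "'i \<Rightarrow> 'a::field^'n"
  assumes inj: "inj_on (\<lambda>a. transv (v a) (phi a)) I"
    and td: "\<forall>a\<in>I. is_transvection_data (v a) (phi a)" and not_P3: "\<not> P3 I v phi"
  shows "cs \<noteq> [] \<Longrightarrow> gamma_walk I v phi (cs @ [hd cs]) \<Longrightarrow>
    walk_coweight v phi (cs @ [hd cs]) = (-1) ^ length cs * walk_weight v phi (cs @ [hd cs])"
proof (induction "length cs" arbitrary: cs rule: less_induct)
  case less
  show ?case
  proof (cases "distinct cs")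
    case True
    show ?thesis
    proof (cases "length cs \<ge> 3")
      case True
      then show ?thesis
        using simple_cycle_coweight[OF inj td not_P3 \<open>distinct cs\<close> _ less.prems(2)] by blast
    next
      case False
      then obtain a rest where cs: "cs = a # rest" and "length rest \<le> 1"
        using less.prems(1) by (cases cs) auto
      then consider "cs = [a]" | b where "cs = [a, b]"
        by (cases rest) auto
      then show ?thesis
      proof cases
        case 1
        then show ?thesis
          using less.prems(2) td unfolding is_transvection_data_def by auto
      qed simp
    qed
  next
    case False
    then obtain xs y ys zs where cs: "cs = xs @ y # ys @ y # zs"
      using not_distinct_decomp by fastforce
    define h where "h = hd cs"
    have hd2: "hd (xs @ y # zs) = h"
      unfolding h_def cs by (cases xs) auto
    have walks: "gamma_walk I v phi (y # ys @ [y])" "gamma_walk I v phi (xs @ y # zs @ [h])"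
      using less.prems(2) gamma_walk_splice[of I v phi xs y ys "zs @ [h]"] unfolding cs h_def
      by auto
    have "walk_coweight v phi (y # ys @ [y]) = (-1) ^ length (y # ys) * walk_weight v phi (y # ys @ [y])"
      using less.hyps[of "y # ys"] walks(1) unfolding cs by simp
    moreover have "walk_coweight v phi (xs @ y # zs @ [h])
        = (-1) ^ length (xs @ y # zs) * walk_weight v phi (xs @ y # zs @ [h])"
      using less.hyps[of "xs @ y # zs"] walks(2) hd2 unfolding cs by simp
    ultimately show ?thesis
      unfolding h_def[symmetric] unfolding cs
      using walk_weight_splice[of v phi xs y ys "zs @ [h]"] walk_coweight_splice[of v phi xs y ys "zs @ [h]"]
      by (simp add: power_add mult_ac)
  qed
qed

definition index_edge :: "'i set \<Rightarrow> ('i \<Rightarrow> 'a::field^'n) \<Rightarrow> ('i \<Rightarrow> 'a^'n) \<Rightarrow> ('i \<times> 'i) set" where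
  "index_edge I v phi = {(a, b). a \<in> I \<and> b \<in> I \<and> fapp (phi b) (v a) \<noteq> 0}"

lemma gamma_edge_reachable_index:
  assumes inj: "inj_on (\<lambda>a. transv (v a) (phi a)) I" and a: "a \<in> I"
    and reach: "(transv (v a) (phi a), r) \<in> (gamma_edge I v phi)\<^sup>*"
  shows "\<exists>b\<in>I. transv (v b) (phi b) = r \<and> (a, b) \<in> (index_edge I v phi)\<^sup>*"
  using reach
proof (induction rule: rtrancl_induct)
  case base
  then show ?case using a by blast
next
  case (step r r')
  then obtain b where b: "b \<in> I" "transv (v b) (phi b) = r" "(a, b) \<in> (index_edge I v phi)\<^sup>*"
    by blast
  obtain c d where "c \<in> I" "d \<in> I" "r = transv (v c) (phi c)" "r' = transv (v d) (phi d)"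
    "fapp (phi d) (v c) \<noteq> 0"
    using step(2) unfolding gamma_edge_def by blast
  moreover have "b = c"
    using inj b calculation by (auto dest: inj_onD)
  ultimately show ?case
    using b by (auto simp: index_edge_def intro: rtrancl_into_rtrancl)
qed

locale connected_singular_family =
  fixes I :: "'i set" and v phi :: "'i \<Rightarrow> 'a::field^'n"
  assumes inj: "inj_on (\<lambda>a. transv (v a) (phi a)) I"
    and td: "\<forall>a\<in>I. is_transvection_data (v a) (phi a)"
    and P2: "P2 I v phi" and not_P3: "\<not> P3 I v phi"
begin

lemma index_reachable:
  assumes a: "a \<in> I" and b: "b \<in> I"
  shows "(a, b) \<in> (index_edge I v phi)\<^sup>*"
proof -
  have "(transv (v a) (phi a), transv (v b) (phi b)) \<in> (gamma_edge I v phi)\<^sup>*"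
    using P2 a b td transv_neq_mat1 unfolding P2_def by blast
  then obtain b' where "b' \<in> I" "transv (v b') (phi b') = transv (v b) (phi b)"
    "(a, b') \<in> (index_edge I v phi)\<^sup>*"
    using gamma_edge_reachable_index[OF inj a] by blast
  moreover have "b' = b"
    using inj calculation(1,2) b by (auto dest: inj_onD)
  ultimately show ?thesis by simp
qed

lemma walk_exists:
  assumes a: "a \<in> I" and b: "b \<in> I"
  shows "\<exists>ps. gamma_walk I v phi ps \<and> ps \<noteq> [] \<and> hd ps = a \<and> last ps = b"
  using index_reachable[OF a b]
proof (induction rule: rtrancl_induct)
  case base
  then show ?case using a by (intro exI[of _ "[a]"]) simp
next
  case (step b c)
  then obtain ps where "gamma_walk I v phi ps" "ps \<noteq> []" "hd ps = a" "last ps = b"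
    by blast
  then show ?case
    using step(2) unfolding index_edge_def by (intro exI[of _ "ps @ [c]"]) (auto simp: gamma_walk_snoc)
qed

lemma closed_walk_coweight:
  assumes walk: "gamma_walk I v phi xs" and len: "2 \<le> length xs" and closed: "hd xs = last xs"
  shows "walk_coweight v phi xs = (-1) ^ (length xs - 1) * walk_weight v phi xs"
proof -
  define cs where "cs = butlast xs"
  have cs: "cs \<noteq> []"
    using len unfolding cs_def by (cases xs) auto
  have "xs = cs @ [last xs]"
    using len unfolding cs_def by (cases xs) auto
  moreover have "hd xs = hd cs"
    using cs calculation by (metis hd_append2)
  ultimately have "xs = cs @ [hd cs]"
    using closed by simp
  then show ?thesis
    using cycle_coweight[OF inj td not_P3 cs] walk by simp
qed

lemma edge_symmetric:
  assumes a: "a \<in> I" and b: "b \<in> I" and e: "fapp (phi b) (v a) \<noteq> 0"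
  shows "fapp (phi a) (v b) \<noteq> 0"
proof -
  obtain ps where ps: "gamma_walk I v phi ps" "ps \<noteq> []" "hd ps = b" "last ps = a"
    using walk_exists[OF b a] by blast
  then obtain rest where ps': "ps = b # rest"
    by (cases ps) auto
  have walk: "gamma_walk I v phi (a # ps)"
    using ps ps' a e by simp
  have "walk_coweight v phi (a # ps) = (-1) ^ (length (a # ps) - 1) * walk_weight v phi (a # ps)"
    by (rule closed_walk_coweight[OF walk]) (use ps ps' in auto)
  moreover have "walk_weight v phi (a # ps) \<noteq> 0"
    by (rule walk_weight_nonzero[OF walk])
  ultimately have "walk_coweight v phi (a # ps) \<noteq> 0"
    by simp
  then show ?thesis
    using ps' by auto
qed

lemma gamma_walk_rev: "gamma_walk I v phi xs \<Longrightarrow> gamma_walk I v phi (rev xs)"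
proof (induction xs rule: induct_list012)
  case (3 x y zs)
  then have "gamma_walk I v phi (rev (y # zs))" "x \<in> I" "y \<in> I" "fapp (phi y) (v x) \<noteq> 0"
    using gamma_walk_subset[of I v phi "y # zs"] by auto
  then have "gamma_walk I v phi (rev (y # zs) @ [x])"
    using edge_symmetric by (subst gamma_walk_snoc) auto
  then show ?case
    by simp
qed auto

lemma walk_coweight_nonzero: "gamma_walk I v phi xs \<Longrightarrow> walk_coweight v phi xs \<noteq> 0"
  using walk_weight_nonzero[OF gamma_walk_rev] walk_coweight_rev[of v phi "rev xs"] by simp

end

definition walk_potential :: "('i \<Rightarrow> 'a::field^'n) \<Rightarrow> ('i \<Rightarrow> 'a^'n) \<Rightarrow> 'i list \<Rightarrow> 'a" where
  "walk_potential v phi ps = (-1) ^ (length ps - 1) * walk_weight v phi ps / walk_coweight v phi ps"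

context connected_singular_family
begin

lemma walk_potential_independent:
  assumes ps: "gamma_walk I v phi ps" "ps \<noteq> []" "hd ps = a0" "last ps = a"
    and qs: "gamma_walk I v phi qs" "qs \<noteq> []" "hd qs = a0" "last qs = a"
  shows "walk_potential v phi ps = walk_potential v phi qs"
proof (cases "length ps = 1 \<and> length qs = 1")
  case True
  then have "ps = [a0]" "qs = [a0]"
    using ps qs by (cases ps; cases qs; auto)+
  then show ?thesis by simp
next
  case False
  \<comment> \<open>go along ps and come back along qs\<close>
  obtain ps' where ps': "ps = ps' @ [a]"
    using ps by (metis append_butlast_last_id)
  have rev_qs: "rev qs = a # tl (rev qs)"
    using qs by (cases "rev qs") (auto simp: last_rev[symmetric])
  define xs where "xs = ps' @ rev qs"
  have weight: "walk_weight v phi xs = walk_weight v phi ps * walk_coweight v phi qs"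
    unfolding xs_def
    using walk_weight_append[of v phi ps' a "tl (rev qs)"] rev_qs ps' walk_coweight_rev[of v phi "rev qs"]
    by simp
  have coweight: "walk_coweight v phi xs = walk_coweight v phi ps * walk_weight v phi qs"
    unfolding xs_def
    using walk_coweight_append[of v phi ps' a "tl (rev qs)"] rev_qs ps' walk_coweight_rev[of v phi qs]
    by simp
  have walk: "gamma_walk I v phi xs"
    unfolding xs_def
    using gamma_walk_append[of I v phi ps' a "tl (rev qs)"] rev_qs ps' gamma_walk_rev[OF qs(1)] ps(1)
    by simp
  have len: "length xs - 1 = (length ps - 1) + (length qs - 1)"
    unfolding xs_def using ps' qs(2) by (cases qs) auto
  have "length xs \<ge> 2"
    using False ps' qs(2) unfolding xs_def by (cases qs) (auto simp: Suc_le_eq)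
  moreover have "hd xs = last xs"
    using ps ps' rev_qs qs unfolding xs_def by (cases ps') (auto simp: hd_rev last_rev)
  ultimately have closed: "walk_coweight v phi ps * walk_weight v phi qs
      = (-1) ^ (length ps - 1) * (-1) ^ (length qs - 1) * (walk_weight v phi ps * walk_coweight v phi qs)"
    using closed_walk_coweight[OF walk] weight coweight len by (simp add: power_add)
  have "(-1::'a) ^ (length qs - 1) * (-1) ^ (length qs - 1) = 1"
    by (simp add: minus_one_power_iff)
  then have "(-1) ^ (length qs - 1) * (walk_coweight v phi ps * walk_weight v phi qs)
      = (-1) ^ (length ps - 1) * walk_weight v phi ps * walk_coweight v phi qs"
    using closed by (simp add: mult_ac)
  moreover have "walk_coweight v phi ps \<noteq> 0" "walk_coweight v phi qs \<noteq> 0"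
    using walk_coweight_nonzero ps(1) qs(1) by auto
  ultimately show ?thesis
    unfolding walk_potential_def by (simp add: field_simps)
qed

definition potential :: "'i \<Rightarrow> 'i \<Rightarrow> 'a" where
  "potential a0 a =
     walk_potential v phi (SOME ps. gamma_walk I v phi ps \<and> ps \<noteq> [] \<and> hd ps = a0 \<and> last ps = a)"

lemma potential_eq_walk_potential:
  assumes "gamma_walk I v phi ps" "ps \<noteq> []" "hd ps = a0" "last ps = a"
  shows "potential a0 a = walk_potential v phi ps"
proof -
  let ?P = "\<lambda>ps. gamma_walk I v phi ps \<and> ps \<noteq> [] \<and> hd ps = a0 \<and> last ps = a"
  have "?P (SOME ps. ?P ps)"
    using assms by (intro someI) blast
  then show ?thesis
    unfolding potential_def using walk_potential_independent assms by blast
qed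

lemma potential_nonzero:
  assumes "a0 \<in> I" "a \<in> I"
  shows "potential a0 a \<noteq> 0"
proof -
  obtain ps where "gamma_walk I v phi ps" "ps \<noteq> []" "hd ps = a0" "last ps = a"
    using walk_exists assms by blast
  then show ?thesis
    using potential_eq_walk_potential walk_weight_nonzero walk_coweight_nonzero
    unfolding walk_potential_def by simp
qed

lemma potential_edge:
  assumes a0: "a0 \<in> I" and a: "a \<in> I" and b: "b \<in> I" and e: "fapp (phi b) (v a) \<noteq> 0"
  shows "potential a0 b = potential a0 a * (- fapp (phi b) (v a) / fapp (phi a) (v b))"
proof -
  obtain ps where ps: "gamma_walk I v phi ps" "ps \<noteq> []" "hd ps = a0" "last ps = a"
    using walk_exists a0 a by blast
  have "potential a0 b = walk_potential v phi (ps @ [b])"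
    using ps b e by (intro potential_eq_walk_potential) (auto simp: gamma_walk_snoc)
  also have "\<dots> = walk_potential v phi ps * (- fapp (phi b) (v a) / fapp (phi a) (v b))"
  proof -
    have "(-1::'a) ^ (length (ps @ [b]) - 1) = - ((-1) ^ (length ps - 1))"
      using ps(2) by (cases ps) auto
    then show ?thesis
      unfolding walk_potential_def using ps by (simp add: walk_weight_snoc walk_coweight_snoc)
  qed
  also have "walk_potential v phi ps = potential a0 a"
    using potential_eq_walk_potential ps by simp
  finally show ?thesis .
qed

lemma potential_skew:
  assumes a0: "a0 \<in> I" and a: "a \<in> I" and b: "b \<in> I"
  shows "fapp (phi a) (v b) / potential a0 a = - (fapp (phi b) (v a) / potential a0 b)"
proof (cases "fapp (phi b) (v a) = 0")
  case True
  then show ?thesis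
    using edge_symmetric[OF b a] by auto
next
  case False
  then show ?thesis
    using edge_symmetric[OF a b False] potential_nonzero[OF a0 a]
    unfolding potential_edge[OF a0 a b False] by (simp add: field_simps)
qed

end

section \<open>Sufficiency of the conditions\<close>

lemma skew_pairing_linear_extension:
  fixes v psi :: "'i \<Rightarrow> 'a::field^'n"
  assumes span: "vec.span (v ` I) = UNIV"
    and skew: "\<forall>a\<in>I. \<forall>b\<in>I. fapp (psi a) (v b) = - fapp (psi b) (v a)"
  shows "\<exists>L. Vector_Spaces.linear (*s) (*s) L \<and>
    (\<forall>a\<in>I. L (v a) = psi a \<and> (\<forall>x. fapp (L x) (v a) = - fapp (psi a) x))"
proof -
  obtain B where B: "B \<subseteq> v ` I" "vec.independent B" "v ` I \<subseteq> vec.span B"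
    using vec.maximal_independent_subset by blast
  define L where "L = vec.construct B (\<lambda>x. psi (SOME a. a \<in> I \<and> v a = x))"
  have lin: "Vector_Spaces.linear (*s) (*s) L"
    unfolding L_def by (rule vec.linear_construct[OF B(2)])
  interpret linear_L: Vector_Spaces.linear "(*s)" "(*s)" L by (rule lin)
  have span_B: "vec.span B = UNIV"
    using span B(3) by (metis top.extremum_uniqueI vec.span_minimal vec.subspace_span)
  have L_skew: "fapp (L x) (v c) = - fapp (psi c) x" if c: "c \<in> I" for c x
  proof -
    have "x \<in> vec.span B" using span_B by auto
    then show ?thesis
    proof (induct rule: vec.span_induct_alt)
      case base
      then show ?case by simp
    next
      case (step k b y)
      define a where "a = (SOME a. a \<in> I \<and> v a = b)"
      have "a \<in> I \<and> v a = b"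
        unfolding a_def by (rule someI_ex) (use step(1) B(1) in blast)
      moreover have "L b = psi a"
        unfolding L_def a_def by (rule vec.construct_basis[OF B(2) step(1)])
      ultimately have "fapp (L b) (v c) = - fapp (psi c) b"
        using skew c by metis
      then show ?case
        using step(2) by (simp add: linear_L.add linear_L.scale fapp_add_left fapp_scale_left fapp_add_right
            fapp_scale_right)
    qed
  qed
  have "L (v a) = psi a" if a: "a \<in> I" for a
  proof (rule fapp_ext)
    fix x
    have "x \<in> vec.span (v ` I)" using span by auto
    then show "fapp (L (v a)) x = fapp (psi a) x"
    proof (induct rule: vec.span_induct_alt)
      case (step k b y)
      then obtain c where c: "c \<in> I" "b = v c" by blast
      then have "fapp (L (v a)) b = fapp (psi a) b"
        using L_skew[OF c(1)] skew a by metis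
      then show ?case using step(2) by (simp add: fapp_add_right fapp_scale_right)
    qed simp
  qed
  then show ?thesis
    using lin L_skew by blast
qed

lemma bform_alternating_of_spanning:
  assumes span: "vec.span S = UNIV"
    and skew: "\<And>s y. s \<in> S \<Longrightarrow> bform J s y = - bform J y s"
    and isotropic: "\<And>s. s \<in> S \<Longrightarrow> bform J s s = 0"
  shows "bform J x x = 0"
proof -
  have skew_all: "bform J x y = - bform J y x" for x y
  proof -
    have "x \<in> vec.span S" using span by auto
    then show ?thesis
    proof (induct rule: vec.span_induct_alt)
      case (step k b x')
      then show ?case
        using skew by (auto simp: bform_add_left bform_add_right bform_scale_left bform_scale_right)
    qed simp
  qed
  have "x \<in> vec.span S" using span by auto
  then show ?thesis
  proof (induct rule: vec.span_induct_alt)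
    case (step k b y)
    have "bform J b y + bform J y b = 0"
      using skew_all[of b y] by simp
    then show ?case
      using step isotropic by (simp add: bform_add_left bform_add_right bform_scale_left
          bform_scale_right algebra_simps) (metis distrib_left mult_zero_right)
  qed simp
qed

lemma alternating_form_of_skew_pairing:
  fixes v psi :: "'i \<Rightarrow> 'a::field^'n"
  assumes span_v: "vec.span (v ` I) = UNIV" and span_psi: "vec.span (psi ` I) = UNIV"
    and skew: "\<forall>a\<in>I. \<forall>b\<in>I. fapp (psi a) (v b) = - fapp (psi b) (v a)"
    and isotropic: "\<forall>a\<in>I. fapp (psi a) (v a) = 0"
  shows "\<exists>J. nondeg_alternating J \<and> (\<forall>a\<in>I. psi a = v a v* J)"
proof -
  obtain L where lin: "Vector_Spaces.linear (*s) (*s) L"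
    and L: "\<And>a. a \<in> I \<Longrightarrow> L (v a) = psi a" "\<And>a x. a \<in> I \<Longrightarrow> fapp (L x) (v a) = - fapp (psi a) x"
    using skew_pairing_linear_extension[OF span_v skew] by blast
  define J where "J = transpose (matrix L)"
  have B: "bform J x y = fapp (L x) y" for x y
    by (simp add: fapp_vector_matrix_mult[symmetric] J_def matrix_works[OF lin])
  have "bform J x x = 0" for x
  proof (rule bform_alternating_of_spanning[OF span_v])
    show "bform J s y = - bform J y s" if "s \<in> v ` I" for s y
      using that L unfolding B by auto
    show "bform J s s = 0" if "s \<in> v ` I" for s
      using that isotropic L(1) unfolding B by auto
  qed
  moreover have "x = 0" if orth: "\<forall>y. bform J x y = 0" for x
  proof -
    have "fapp (psi a) x = 0" if "a \<in> I" for a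
      using orth L(2)[OF that, of x] unfolding B by simp
    then have "fapp p x = 0" for p
      using span_psi fapp_commute fapp_eq_0_on_span[of p "psi ` I" x] by (metis UNIV_I image_iff)
    then show "x = 0"
      using nonzero_vector_has_nonzero_fapp by metis
  qed
  moreover have "psi a = v a v* J" if "a \<in> I" for a
    unfolding J_def vector_transpose_matrix matrix_works[OF lin] L(1)[OF that] ..
  ultimately show ?thesis
    unfolding nondeg_alternating_def by blast
qed

lemma SK_eq_symp_transv:
  assumes "\<forall>a\<in>I. c a \<noteq> 0 \<and> phi a = c a *s (v a v* J)"
  shows "SK I v phi = {symp_transv J (v a) mu | mu a. a \<in> I}"
proof -
  have SK: "transv (lam *s v a) (phi a) = symp_transv J (v a) (lam * c a)" if "a \<in> I" for a lam
    using assms that unfolding symp_transv_def by (simp add: transv_scale)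
  show ?thesis
  proof
    show "SK I v phi \<subseteq> {symp_transv J (v a) mu | mu a. a \<in> I}"
      unfolding SK_def using SK by blast
    show "{symp_transv J (v a) mu | mu a. a \<in> I} \<subseteq> SK I v phi"
    proof clarify
      fix mu a assume a: "a \<in> I"
      then have "symp_transv J (v a) mu = transv ((mu / c a) *s v a) (phi a)"
        using SK[OF a, of "mu / c a"] assms by simp
      then show "symp_transv J (v a) mu \<in> SK I v phi"
        unfolding SK_def using a by blast
    qed
  qed
qed

context connected_singular_family
begin

lemma symplectic_rescaling:
  assumes P1: "P1 I v phi"
  shows "\<exists>J c. nondeg_alternating J \<and> (\<forall>a\<in>I. c a \<noteq> 0 \<and> phi a = c a *s (v a v* J))"
proof -
  have span_v: "vec.span (v ` I) = UNIV" and span_phi: "vec.span (phi ` I) = UNIV"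
    using P1 unfolding P1_def by auto
  have "I \<noteq> {}"
  proof
    assume "I = {}"
    then have "(1::'a^'n) \<in> {0}"
      using span_v by (metis UNIV_I image_empty vec.span_empty)
    then show False by simp
  qed
  then obtain a0 where a0: "a0 \<in> I" by blast
  define c where "c a = potential a0 a" for a
  define psi where "psi a = (1 / c a) *s phi a" for a
  have c: "c a \<noteq> 0" if "a \<in> I" for a
    unfolding c_def using potential_nonzero[OF a0 that] .
  have phi_psi: "phi a = c a *s psi a" if "a \<in> I" for a
    using c[OF that] unfolding psi_def by (simp add:)
  have "phi ` I \<subseteq> vec.span (psi ` I)"
    using phi_psi by (auto intro: vec.span_scale vec.span_base)
  then have span_psi: "vec.span (psi ` I) = UNIV"
    using span_phi by (metis top.extremum_uniqueI vec.span_minimal vec.subspace_span)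
  have "fapp (psi a) (v b) = - fapp (psi b) (v a)" if "a \<in> I" "b \<in> I" for a b
    using potential_skew[OF a0 that] unfolding psi_def c_def by (simp add: fapp_scale_left)
  then have "\<forall>a\<in>I. \<forall>b\<in>I. fapp (psi a) (v b) = - fapp (psi b) (v a)"
    by blast
  moreover have "\<forall>a\<in>I. fapp (psi a) (v a) = 0"
    using td unfolding psi_def is_transvection_data_def by (simp add: fapp_scale_left)
  ultimately obtain J where "nondeg_alternating J" "\<forall>a\<in>I. psi a = v a v* J"
    using alternating_form_of_skew_pairing[OF span_v span_psi] by blast
  then show ?thesis
    using c phi_psi by auto
qed

theorem generates_symplectic_group:
  assumes field_not_F2: "\<exists>c::'a. c \<noteq> 0 \<and> c \<noteq> 1" and P1: "P1 I v phi"
  shows "\<exists>J. nondeg_alternating J \<and> gen_group (SK I v phi) = symplectic_group J"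
proof -
  obtain J c where J: "nondeg_alternating J" and phi: "\<forall>a\<in>I. c a \<noteq> 0 \<and> phi a = c a *s (v a v* J)"
    using symplectic_rescaling[OF P1] by blast
  interpret symplectic_space J
    using J by unfold_locales
  have "fapp (phi b) (v a) = - (c b * bform J (v a) (v b))" if "b \<in> I" for a b
    using phi that bform_skew[of "v b" "v a"] by (simp add: fapp_scale_left fapp_vector_matrix_mult)
  then have "index_edge I v phi \<subseteq> {(a, b). a \<in> I \<and> b \<in> I \<and> bform J (v a) (v b) \<noteq> 0}"
    unfolding index_edge_def by auto
  then have "(a, b) \<in> {(a, b). a \<in> I \<and> b \<in> I \<and> bform J (v a) (v b) \<noteq> 0}\<^sup>*"
    if "a \<in> I" "b \<in> I" for a b
    using index_reachable[OF that] rtrancl_mono by blast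
  moreover have "vec.span (v ` I) = UNIV"
    using P1 unfolding P1_def by simp
  moreover have "v a \<noteq> 0" if "a \<in> I" for a
    using td that unfolding is_transvection_data_def by simp
  ultimately have "gen_group {symp_transv J (v a) mu | mu a. a \<in> I} = symplectic_group J"
    using symp_transv_family_generates[OF field_not_F2] by blast
  then show ?thesis
    using J SK_eq_symp_transv[OF phi] by auto
qed

end

lemma transv_eq_scaled:
  assumes a: "is_transvection_data d p" and b: "is_transvection_data d' p'"
    and eq: "transv d p = transv d' p'"
  shows "\<exists>s. s \<noteq> 0 \<and> d' = s *s d \<and> p = s *s p'"
proof -
  have h: "fapp p x *s d = fapp p' x *s d'" for x
    using transv_eqD[OF eq] .
  obtain i where i: "fapp p (axis i 1) \<noteq> 0"
    using a nonzero_vector_has_nonzero_fapp fapp_commute unfolding is_transvection_data_def by metis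
  define s where "s = fapp p (axis i 1) / fapp p' (axis i 1)"
  have i': "fapp p' (axis i 1) \<noteq> 0"
    using h[of "axis i 1"] i a unfolding is_transvection_data_def by auto
  have "d' = (1 / fapp p' (axis i 1)) *s (fapp p' (axis i 1) *s d')"
    using i' by (simp add:)
  also have "\<dots> = s *s d"
    unfolding h[symmetric] s_def by (simp add:)
  finally have d': "d' = s *s d" .
  have s: "s \<noteq> 0"
    using d' b unfolding is_transvection_data_def by auto
  have "fapp p x = s * fapp p' x" for x
  proof -
    have "fapp p x *s d = (s * fapp p' x) *s d"
      using h[of x] unfolding d' by (simp add: mult.commute)
    then show ?thesis
      using a unfolding is_transvection_data_def by (metis vector_mul_rcancel)
  qed
  then have "p = s *s p'"
    by (intro fapp_ext) (simp add: fapp_scale_left)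
  then show ?thesis
    using s d' by blast
qed

context
  fixes I :: "'i set" and v phi :: "'i \<Rightarrow> 'a::field^'n" and rep :: "'i \<Rightarrow> 'i"
  assumes rep_mem: "\<And>a. a \<in> I \<Longrightarrow> rep a \<in> I"
    and rep_scaled: "\<And>a. a \<in> I \<Longrightarrow> \<exists>s. s \<noteq> 0 \<and> v a = s *s v (rep a) \<and> phi (rep a) = s *s phi a"
begin

lemma transv_rep: "a \<in> I \<Longrightarrow> transv (lam *s v (rep a)) (phi (rep a)) = transv (lam *s v a) (phi a)"
  using rep_scaled[of a]
  by (auto intro!: transv_eqI simp: fapp_scale_left mult_ac)

lemma SK_rep_image: "SK (rep ` I) v phi = SK I v phi"
proof
  show "SK (rep ` I) v phi \<subseteq> SK I v phi"
    using rep_mem unfolding SK_def by blast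
  show "SK I v phi \<subseteq> SK (rep ` I) v phi"
  proof
    fix g assume "g \<in> SK I v phi"
    then obtain lam a where g: "g = transv (lam *s v a) (phi a)" and a: "a \<in> I"
      unfolding SK_def by blast
    then have "g = transv (lam *s v (rep a)) (phi (rep a))"
      using transv_rep by simp
    then show "g \<in> SK (rep ` I) v phi"
      unfolding SK_def using a by blast
  qed
qed

lemma P1_rep_image:
  assumes "P1 I v phi"
  shows "P1 (rep ` I) v phi"
proof -
  have "v a \<in> vec.span (v ` rep ` I)" "phi a \<in> vec.span (phi ` rep ` I)" if a: "a \<in> I" for a
  proof -
    obtain s where "s \<noteq> 0" "v a = s *s v (rep a)" "phi a = (1 / s) *s phi (rep a)"
      using rep_scaled[OF a] by (auto simp:)
    then show "v a \<in> vec.span (v ` rep ` I)" "phi a \<in> vec.span (phi ` rep ` I)"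
      using a by (auto intro: vec.span_scale vec.span_base)
  qed
  then have "vec.span (v ` I) \<subseteq> vec.span (v ` rep ` I)"
    "vec.span (phi ` I) \<subseteq> vec.span (phi ` rep ` I)"
    by (intro vec.span_minimal vec.subspace_span; auto)+
  then show ?thesis
    using assms unfolding P1_def by auto
qed

lemma P2_rep_image:
  assumes "P2 I v phi"
  shows "P2 (rep ` I) v phi"
proof -
  let ?t = "\<lambda>a. transv (v a) (phi a)"
  have "gamma_edge I v phi \<subseteq> gamma_edge (rep ` I) v phi"
  proof clarify
    fix r1 r2 assume "(r1, r2) \<in> gamma_edge I v phi"
    then obtain a b where ab: "a \<in> I" "b \<in> I" "r1 = ?t a" "r2 = ?t b" "fapp (phi b) (v a) \<noteq> 0"
      "r1 \<noteq> mat 1" "r2 \<noteq> mat 1"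
      unfolding gamma_edge_def by blast
    obtain s where s: "s \<noteq> 0" "v a = s *s v (rep a)"
      using rep_scaled[OF ab(1)] by blast
    obtain s' where s': "s' \<noteq> 0" "phi (rep b) = s' *s phi b"
      using rep_scaled[OF ab(2)] by blast
    have "fapp (phi (rep b)) (v (rep a)) = s' / s * fapp (phi b) (v a)"
      using s unfolding s'(2) s(2) by (simp add: fapp_scale_left fapp_scale_right)
    then have "fapp (phi (rep b)) (v (rep a)) \<noteq> 0"
      using s s' ab(5) by simp
    moreover have "r1 = ?t (rep a)" "r2 = ?t (rep b)"
      using transv_rep[of _ 1] ab by auto
    ultimately show "(r1, r2) \<in> gamma_edge (rep ` I) v phi"
      unfolding gamma_edge_def mem_Collect_eq case_prod_conv using ab(1,2,6,7) by blast
  qed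
  then have "gamma_edge (rep ` I) v phi = gamma_edge I v phi"
    using rep_mem unfolding gamma_edge_def by blast
  moreover have "?t ` rep ` I = ?t ` I"
    using rep_mem transv_rep[of _ 1] by (auto simp: image_iff)
  ultimately show ?thesis
    using assms unfolding P2_def by simp
qed

end

lemma injective_representatives:
  fixes I :: "'i set" and v phi :: "'i \<Rightarrow> 'a::field^'n"
  assumes td: "\<forall>a\<in>I. is_transvection_data (v a) (phi a)"
  obtains I' where "I' \<subseteq> I" "inj_on (\<lambda>a. transv (v a) (phi a)) I'" "SK I' v phi = SK I v phi"
    "P1 I v phi \<Longrightarrow> P1 I' v phi" "P2 I v phi \<Longrightarrow> P2 I' v phi" "\<not> P3 I v phi \<Longrightarrow> \<not> P3 I' v phi"
proof -
  let ?t = "\<lambda>a. transv (v a) (phi a)"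
  define rep where "rep a = (SOME b. b \<in> I \<and> ?t b = ?t a)" for a
  have rep: "rep a \<in> I \<and> ?t (rep a) = ?t a" if "a \<in> I" for a
    unfolding rep_def by (rule someI_ex) (use that in blast)
  have scaled: "\<exists>s. s \<noteq> 0 \<and> v a = s *s v (rep a) \<and> phi (rep a) = s *s phi a" if a: "a \<in> I" for a
    using transv_eq_scaled[of "v (rep a)" "phi (rep a)" "v a" "phi a"] td rep[OF a] a by auto
  have "inj_on ?t (rep ` I)"
  proof (rule inj_onI)
    fix x y assume "x \<in> rep ` I" "y \<in> rep ` I" "?t x = ?t y"
    then obtain a b where "x = rep a" "y = rep b" "?t a = ?t b"
      using rep by force
    then show "x = y"
      unfolding rep_def by simp
  qed
  moreover have "\<not> P3 (rep ` I) v phi" if "\<not> P3 I v phi"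
    using that rep unfolding P3_def nonsingular_cycle_def Let_def by blast
  moreover have rep_mem: "rep a \<in> I" if "a \<in> I" for a
    using rep that by blast
  ultimately show ?thesis
    using that[of "rep ` I"] SK_rep_image[of I rep v phi, OF rep_mem scaled]
      P1_rep_image[of I rep v phi, OF rep_mem scaled] P2_rep_image[of I rep v phi, OF rep_mem scaled]
    by blast
qed

theorem corollary5p3:
  fixes I :: "'i set" and v phi :: "'i \<Rightarrow> 'a::field^'n"
  assumes notF2: "\<exists>c::'a. c \<noteq> 0 \<and> c \<noteq> 1"
    and dim: "CARD('n) \<ge> 3"
    and transv: "\<forall>a\<in>I. is_transvection_data (v a) (phi a)"
  shows "(\<exists>J. nondeg_alternating J \<and> gen_group (SK I v phi) = symplectic_group J)
         \<longleftrightarrow> P1 I v phi \<and> P2 I v phi \<and> \<not> P3 I v phi"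
proof
  \<comment> \<open>The argument works in every dimension.\<close>
  assume "\<exists>J. nondeg_alternating J \<and> gen_group (SK I v phi) = symplectic_group J"
  then obtain J where "nondeg_alternating J" "gen_group (SK I v phi) = symplectic_group J"
    by blast
  then show "P1 I v phi \<and> P2 I v phi \<and> \<not> P3 I v phi"
    using symplectic_space.generating_family_properties[OF _ transv] by (simp add: symplectic_space_def)
next
  assume P: "P1 I v phi \<and> P2 I v phi \<and> \<not> P3 I v phi"
  obtain I' where I': "I' \<subseteq> I" "inj_on (\<lambda>a. transv (v a) (phi a)) I'" "SK I' v phi = SK I v phi"
    "P1 I' v phi" "P2 I' v phi" "\<not> P3 I' v phi"
    using injective_representatives[OF transv] P by metis
  interpret connected_singular_family I' v phi
    using I' transv by unfold_locales auto
  show "\<exists>J. nondeg_alternating J \<and> gen_group (SK I v phi) = symplectic_group J"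
    using generates_symplectic_group[OF notF2 I'(4)] I'(3) by simp
qed

end
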